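(* Let $(\mathscr{M};\mathcal{H})$, $(\mathscr{N};\mathcal{K})$ be represented von Neumann algebras and $\Phi:\mathscr{M}\to\mathscr{N}$ be a unital normal $*$-homomorphism. Let $\Phi_{\mathrm{aff}}:\mathscr{M}_{\mathrm{aff}}\to\mathscr{N}_{\mathrm{aff}}$ be the extension of $\Phi$ given by $\Phi_{\mathrm{aff}}(A/B)=\Phi(A)/\Phi(B)$. Then for every $T\in\mathscr{M}_{\mathrm{aff}}^{\mathrm{MvN}}$, $$\chi\big(\Phi_{\mathrm{aff}}(T)\big)=\Phi_{(2)}\big(\chi(T)\big).$$ In other words, the extension $\Phi_{\mathrm{aff}}:\mathscr{M}_{\mathrm{aff}}^{\mathrm{MvN}}\to\mathscr{N}_{\mathrm{aff}}^{\mathrm{MvN}}$ of $\Phi$ is the mapping $T\mapsto(\chi^{-1}\circ\Phi_{(2)}\circ\chi)(T)$.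
   Context: A represented von Neumann algebra $(\mathscr{M};\mathcal{H})$ is a von Neumann algebra $\mathscr{M}$ acting on a complex Hilbert space $\mathcal{H}$; $M_2(\mathscr{M})$ acts on $\mathcal{H}\oplus\mathcal{H}$. An unbounded operator on $\mathcal{H}$ is a linear map $T:\mathrm{dom}(T)\to\mathcal{H}$ with $\mathrm{dom}(T)$ a (not necessarily dense) linear subspace of $\mathcal{H}$, and $T$ not necessarily bounded. $T$ is closed if its graph $\{(x,Tx):x\in\mathrm{dom}(T)\}$ is closed in $\mathcal{H}\oplus\mathcal{H}$. For $A,B\in\mathcal{B}(\mathcal{H})$ with $\mathrm{null}(B)\subseteq\mathrm{null}(A)$, the quotient $A/B$ is the unbounded operator with domain $\mathrm{ran}(B)$ given by $Bx\mapsto Ax$ ($x\in\mathcal{H}$). $\mathscr{M}_{\mathrm{aff}} := \{A/B : A,B\in\mathscr{M},\ \mathrm{null}(B)\subseteq\mathrm{null}(A)\}$. The map $\Phi_{\mathrm{aff}}$, $A/B\mapsto\Phi(A)/\Phi(B)$, makes sense and does not depend on the choice of quotient representation. $\mathscr{M}_{\mathrm{aff}}^{\mathrm{MvN}}$ is the set of closed operators $T$ on $\mathcal{H}$ with $U^*TU=T$ for every unitary $U\in\mathscr{M}'$; it coincides with the set of closed operators in $\mathscr{M}_{\mathrm{aff}}$, and $\Phi_{\mathrm{aff}}$ maps it into $\mathscr{N}_{\mathrm{aff}}^{\mathrm{MvN}}$. $\chi(T)$ is the characteristic projection of $T$, i.e. the orthogonal projection of $\mathcal{H}\oplus\mathcal{H}$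 onto the closure of the graph of $T$; for $T\in\mathscr{M}_{\mathrm{aff}}^{\mathrm{MvN}}$ it lies in $M_2(\mathscr{M})$, and $\chi$ is injective on closed operators. $\Phi_{(2)}:M_2(\mathscr{M})\to M_2(\mathscr{N})$ applies $\Phi$ entrywise. *)

theory Defs
  imports "HOL-Analysis.Analysis"
begin

section \<open>Complex Hilbert spaces\<close>

text \<open>The norm and the topology are those of the underlying real Hilbert space, whose inner product
  is the real part of the complex one; \<open>cinner\<close> is linear in its first argument.\<close>

class chilbert = banach + real_inner +
  fixes scaleC :: "complex \<Rightarrow> 'a \<Rightarrow> 'a"
    and cinner :: "'a \<Rightarrow> 'a \<Rightarrow> complex"
  assumes scaleC_add_right: "scaleC c (x + y) = scaleC c x + scaleC c y"
    and scaleC_add_left: "scaleC (c + d) x = scaleC c x + scaleC d x"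
    and scaleC_scaleC: "scaleC c (scaleC d x) = scaleC (c * d) x"
    and scaleR_scaleC: "scaleR r x = scaleC (complex_of_real r) x"
    and cinner_commute: "cinner x y = cnj (cinner y x)"
    and cinner_add_left: "cinner (x + y) z = cinner x z + cinner y z"
    and cinner_scaleC_left: "cinner (scaleC c x) y = c * cinner x y"
    and inner_eq_Re_cinner: "inner x y = Re (cinner x y)"

text \<open>The Hilbert space \<open>\<H> \<oplus> \<K>\<close>.\<close>

instantiation prod :: (chilbert, chilbert) chilbert
begin

definition scaleC_prod_def: "scaleC c z = (scaleC c (fst z), scaleC c (snd z))"

definition cinner_prod_def: "cinner z w = cinner (fst z) (fst w) + cinner (snd z) (snd w)"

instance
proof
  fix c d :: complex and r :: real and x y z :: "'a \<times> 'b"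
  show "scaleC c (x + y) = scaleC c x + scaleC c y"
    by (simp add: scaleC_prod_def scaleC_add_right)
  show "scaleC (c + d) x = scaleC c x + scaleC d x"
    by (simp add: scaleC_prod_def scaleC_add_left)
  show "scaleC c (scaleC d x) = scaleC (c * d) x"
    by (simp add: scaleC_prod_def scaleC_scaleC)
  show "scaleR r x = scaleC (complex_of_real r) x"
    by (simp add: scaleC_prod_def scaleR_prod_def scaleR_scaleC)
  show "cinner x y = cnj (cinner y x)"
    unfolding cinner_prod_def complex_cnj_add by (metis cinner_commute)
  show "cinner (x + y) z = cinner x z + cinner y z"
    by (simp add: cinner_prod_def cinner_add_left)
  show "cinner (scaleC c x) y = c * cinner x y"
    by (simp add: cinner_prod_def scaleC_prod_def cinner_scaleC_left distrib_left)
  show "inner x y = Re (cinner x y)"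
    by (simp add: cinner_prod_def inner_prod_def inner_eq_Re_cinner)
qed

end

section \<open>Bounded operators and von Neumann algebras\<close>

definition bounded_ops :: "('h::chilbert \<Rightarrow> 'h) set" where
  "bounded_ops = {A. bounded_linear A \<and> (\<forall>c x. A (scaleC c x) = scaleC c (A x))}"

definition cadj :: "('h::chilbert \<Rightarrow> 'h) \<Rightarrow> ('h \<Rightarrow> 'h)" where
  "cadj A = (THE B. \<forall>x y. cinner (A x) y = cinner x (B y))"

definition unitary_op :: "('h::chilbert \<Rightarrow> 'h) \<Rightarrow> bool" where
  "unitary_op U \<longleftrightarrow> U \<in> bounded_ops \<and> cadj U \<circ> U = id \<and> U \<circ> cadj U = id"

definition commutant :: "('h::chilbert \<Rightarrow> 'h) set \<Rightarrow> ('h \<Rightarrow> 'h) set" where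
  "commutant M = {A \<in> bounded_ops. \<forall>B\<in>M. A \<circ> B = B \<circ> A}"

definition von_neumann_algebra :: "('h::chilbert \<Rightarrow> 'h) set \<Rightarrow> bool" where
  "von_neumann_algebra M \<longleftrightarrow>
     M \<subseteq> bounded_ops \<and> (\<forall>A\<in>M. cadj A \<in> M) \<and> commutant (commutant M) = M"

definition unital_star_hom ::
    "('h::chilbert \<Rightarrow> 'h) set \<Rightarrow> ('k::chilbert \<Rightarrow> 'k) set \<Rightarrow> (('h \<Rightarrow> 'h) \<Rightarrow> ('k \<Rightarrow> 'k)) \<Rightarrow> bool" where
  "unital_star_hom M N \<Phi> \<longleftrightarrow>
     \<Phi> \<in> M \<rightarrow> N \<and>
     (\<forall>A\<in>M. \<forall>B\<in>M. \<Phi> (\<lambda>x. A x + B x) = (\<lambda>y. \<Phi> A y + \<Phi> B y)) \<and>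
     (\<forall>c. \<forall>A\<in>M. \<Phi> (\<lambda>x. scaleC c (A x)) = (\<lambda>y. scaleC c (\<Phi> A y))) \<and>
     (\<forall>A\<in>M. \<forall>B\<in>M. \<Phi> (A \<circ> B) = \<Phi> A \<circ> \<Phi> B) \<and>
     (\<forall>A\<in>M. \<Phi> (cadj A) = cadj (\<Phi> A)) \<and>
     \<Phi> id = id"

definition selfadj :: "('h::chilbert \<Rightarrow> 'h) set \<Rightarrow> ('h \<Rightarrow> 'h) set" where
  "selfadj M = {A \<in> M. cadj A = A}"

text \<open>The order of self-adjoint operators, for which \<open>\<langle>A x, x\<rangle>\<close> is real.\<close>

definition op_le :: "('h::chilbert \<Rightarrow> 'h) \<Rightarrow> ('h \<Rightarrow> 'h) \<Rightarrow> bool" where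
  "op_le A B \<longleftrightarrow> (\<forall>x. Re (cinner (A x) x) \<le> Re (cinner (B x) x))"

definition op_lub :: "('h::chilbert \<Rightarrow> 'h) set \<Rightarrow> ('h \<Rightarrow> 'h) set \<Rightarrow> ('h \<Rightarrow> 'h) \<Rightarrow> bool" where
  "op_lub M D S \<longleftrightarrow> S \<in> selfadj M \<and> (\<forall>A\<in>D. op_le A S) \<and>
     (\<forall>R\<in>selfadj M. (\<forall>A\<in>D. op_le A R) \<longrightarrow> op_le S R)"

text \<open>Normality: suprema of bounded increasing nets of self-adjoint elements are preserved. Only the
  range of the net matters, so nets are replaced by upward directed sets.\<close>

definition normal_map ::
    "('h::chilbert \<Rightarrow> 'h) set \<Rightarrow> ('k::chilbert \<Rightarrow> 'k) set \<Rightarrow> (('h \<Rightarrow> 'h) \<Rightarrow> ('k \<Rightarrow> 'k)) \<Rightarrow> bool" where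
  "normal_map M N \<Phi> \<longleftrightarrow>
     (\<forall>D S. D \<subseteq> selfadj M \<and> D \<noteq> {} \<and>
        (\<forall>A\<in>D. \<forall>B\<in>D. \<exists>C\<in>D. op_le A C \<and> op_le B C) \<and> op_lub M D S \<longrightarrow>
        op_lub N (\<Phi> ` D) (\<Phi> S))"

section \<open>Unbounded operators\<close>

text \<open>An unbounded operator is a partial function, so that two of them are equal iff they have the
  same domain and the same values there. Its graph is the library's \<open>Map.graph\<close>.\<close>

definition unbounded_op :: "('h::chilbert \<rightharpoonup> 'h) \<Rightarrow> bool" where
  "unbounded_op T \<longleftrightarrow>
     0 \<in> dom T \<and>
     (\<forall>x\<in>dom T. \<forall>y\<in>dom T. x + y \<in> dom T \<and> the (T (x + y)) = the (T x) + the (T y)) \<and>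
     (\<forall>c. \<forall>x\<in>dom T. scaleC c x \<in> dom T \<and> the (T (scaleC c x)) = scaleC c (the (T x)))"

definition closed_op :: "('h::chilbert \<rightharpoonup> 'h) \<Rightarrow> bool" where
  "closed_op T \<longleftrightarrow> unbounded_op T \<and> closed (Map.graph T)"

definition null :: "('h::chilbert \<Rightarrow> 'h) \<Rightarrow> 'h set" where
  "null A = {x. A x = 0}"

text \<open>\<open>A / B\<close>, meaningful if \<open>null B \<subseteq> null A\<close>.\<close>

definition quot :: "('h::chilbert \<Rightarrow> 'h) \<Rightarrow> ('h \<Rightarrow> 'h) \<Rightarrow> ('h \<rightharpoonup> 'h)" where
  "quot A B = (\<lambda>y. if y \<in> range B then Some (THE z. \<exists>x. y = B x \<and> z = A x) else None)"

definition aff :: "('h::chilbert \<Rightarrow> 'h) set \<Rightarrow> ('h \<rightharpoonup> 'h) set" where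
  "aff M = {quot A B | A B. A \<in> M \<and> B \<in> M \<and> null B \<subseteq> null A}"

definition aff_ext ::
    "('h::chilbert \<Rightarrow> 'h) set \<Rightarrow> (('h \<Rightarrow> 'h) \<Rightarrow> ('k::chilbert \<Rightarrow> 'k)) \<Rightarrow> ('h \<rightharpoonup> 'h) \<Rightarrow> ('k \<rightharpoonup> 'k)" where
  "aff_ext M \<Phi> = (\<lambda>T\<in>aff M. THE S. \<exists>A\<in>M. \<exists>B\<in>M.
     null B \<subseteq> null A \<and> T = quot A B \<and> S = quot (\<Phi> A) (\<Phi> B))"

text \<open>In \<open>U\<^sup>* T U\<close> the domain is \<open>{x. U x \<in> dom T}\<close>.\<close>

definition aff_MvN :: "('h::chilbert \<Rightarrow> 'h) set \<Rightarrow> ('h \<rightharpoonup> 'h) set" where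
  "aff_MvN M = {T. closed_op T \<and>
     (\<forall>U\<in>commutant M. unitary_op U \<longrightarrow> (\<lambda>x. map_option (cadj U) (T (U x))) = T)}"

definition orth_proj :: "'h::chilbert set \<Rightarrow> 'h \<Rightarrow> 'h" where
  "orth_proj V x = (THE v. v \<in> V \<and> (\<forall>w\<in>V. cinner (x - v) w = 0))"

definition charproj :: "('h::chilbert \<rightharpoonup> 'h) \<Rightarrow> ('h \<times> 'h \<Rightarrow> 'h \<times> 'h)" where
  "charproj T = orth_proj (closure (Map.graph T))"

section \<open>Two by two matrices of operators\<close>

definition opmat ::
    "('h::chilbert \<Rightarrow> 'h) \<Rightarrow> ('h \<Rightarrow> 'h) \<Rightarrow> ('h \<Rightarrow> 'h) \<Rightarrow> ('h \<Rightarrow> 'h) \<Rightarrow> ('h \<times> 'h \<Rightarrow> 'h \<times> 'h)" where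
  "opmat A B C D = (\<lambda>(x, y). (A x + B y, C x + D y))"

definition mat2 :: "('h::chilbert \<Rightarrow> 'h) set \<Rightarrow> ('h \<times> 'h \<Rightarrow> 'h \<times> 'h) set" where
  "mat2 M = {opmat A B C D | A B C D. A \<in> M \<and> B \<in> M \<and> C \<in> M \<and> D \<in> M}"

text \<open>\<open>\<Phi>\<^sub>(\<^sub>2\<^sub>)\<close>; the arguments of \<open>\<Phi>\<close> are the matrix entries of \<open>S\<close>.\<close>

definition entrywise ::
    "('h::chilbert \<Rightarrow> 'h) set \<Rightarrow> (('h \<Rightarrow> 'h) \<Rightarrow> ('k::chilbert \<Rightarrow> 'k)) \<Rightarrow>
     ('h \<times> 'h \<Rightarrow> 'h \<times> 'h) \<Rightarrow> ('k \<times> 'k \<Rightarrow> 'k \<times> 'k)" where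
  "entrywise M \<Phi> = (\<lambda>S\<in>mat2 M. opmat
     (\<Phi> (\<lambda>x. fst (S (x, 0)))) (\<Phi> (\<lambda>y. fst (S (0, y))))
     (\<Phi> (\<lambda>x. snd (S (x, 0)))) (\<Phi> (\<lambda>y. snd (S (0, y)))))"

end

theory Submission
  imports Defs
begin

text \<open>
  Let \<open>P = \<chi>(T)\<close>, with entries \<open>P\<^sub>i\<^sub>j \<in> M\<close>. Put \<open>B = P\<^sub>1\<^sub>1\<^sup>1\<^sup>/\<^sup>2\<close> and let \<open>A\<close> be \<open>P\<^sub>2\<^sub>1 B\<^sup>-\<^sup>1\<close>, extended by
  \<open>0\<close> to the kernel of \<open>B\<close>. The column \<open>W = (B, A)\<close> is a partial isometry with \<open>W W\<^sup>* = P\<close>, and \<open>W\<^sup>* W\<close> is the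
  support projection \<open>E\<close> of \<open>B\<close>; so the graph of \<open>T\<close> is the range of \<open>W\<close> and \<open>T = A / B\<close>. Being
  algebraic, these identities pass to \<open>\<Phi>(W) = (\<Phi>(B), \<Phi>(A))\<close>; normality gives that \<open>\<Phi>(E)\<close> vanishes
  on the kernel of \<open>\<Phi>(B)\<close>. Hence the graph of \<open>\<Phi>(A) / \<Phi>(B)\<close> is the closed range of \<open>\<Phi>(W)\<close>, and the
  projection onto it is \<open>\<Phi>(W) \<Phi>(W)\<^sup>*\<close>, whose entries are the \<open>\<Phi>(P\<^sub>i\<^sub>j)\<close>.
\<close>

section \<open>Hilbert space preliminaries\<close>

text \<open>The obstacle is that \<open>\<Phi>\<close> sees only algebra and suprema, whereas the
  graph of a quotient need not be closed and the projection onto its closure is in general no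
  polynomial in the entries. Choosing the column W to be a partial isometry removes this: closedness
  of its range, the projection onto it and the comparison with other representations become operator
  identities. The kernel condition is not of this kind; it is recovered because E is the supremum in
  \<open>M\<close> of the increasing sequence 1 - (1 - B)^n, whose terms \<open>\<Phi>\<close> maps
  to the same polynomials in \<open>\<Phi> B\<close>. The support thus comes from powers of 1 - B,
  the square root from the binomial series, the quotient from Neumann sums. The first column of P
  suffices because T is single valued: no nonzero (0, y) lies in its graph, so the vectors P(x, 0)
  are dense there. Affiliation speaks of unitaries of the commutant, so the entries of P must be
  shown to commute with the rest of it too. Finally, \<open>aff_ext\<close> is a definite
  description, so all representations of T must be compared.\<close>

lemma real_inner_eqI:
  fixes x y :: "'a::real_inner"
  assumes "\<And>z. inner x z = inner y z"
  shows "x = y"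
proof -
  have "inner (x - y) (x - y) = 0"
    using assms by (simp add: inner_diff_left)
  then show ?thesis by simp
qed

text \<open>A minimising sequence for the distance is Cauchy by the parallelogram law; varying its
  limit along \<open>w\<close> gives orthogonality.\<close>

lemma orthogonal_projection_exists:
  fixes V :: "'a::{real_inner,banach} set"
  assumes V: "subspace V" "closed V"
  shows "\<exists>v\<in>V. \<forall>w\<in>V. inner (x - v) w = 0"
proof -
  define d where "d = infdist x V"
  have ne: "V \<noteq> {}" using subspace_0[OF V(1)] by auto
  have d0: "0 \<le> d" unfolding d_def by (rule infdist_nonneg)
  have "\<exists>v\<in>V. dist x v < d + 1 / Suc n" for n
  proof -
    have "infdist x V < d + 1 / Suc n" unfolding d_def by simp
    then show ?thesis using ne unfolding infdist_notempty[OF ne]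
      by (subst (asm) cInf_less_iff) auto
  qed
  then obtain u where uV: "\<And>n. u n \<in> V" and ud: "\<And>n. dist x (u n) < d + 1 / Suc n"
    by metis
  have lower: "d \<le> norm (x - v)" if "v \<in> V" for v
    using infdist_le[OF that, of x] by (simp add: d_def dist_norm)
  have sq: "(norm (x - u n))\<^sup>2 \<le> d\<^sup>2 + (2 * d + 1) / Suc n" for n
  proof -
    have "(norm (x - u n))\<^sup>2 \<le> (d + 1 / Suc n)\<^sup>2"
      using ud[of n] by (intro power_mono) (auto simp: dist_norm)
    also have "\<dots> = d\<^sup>2 + 2 * d * (1 / Suc n) + (1 / Suc n) * (1 / Suc n)"
      by (simp add: power2_eq_square algebra_simps)
    also have "\<dots> \<le> d\<^sup>2 + 2 * d * (1 / Suc n) + 1 * (1 / Suc n)"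
      by (intro add_left_mono mult_right_mono) auto
    finally show ?thesis by (simp add: add_divide_distrib)
  qed
  have par: "(norm (u m - u n))\<^sup>2 \<le> 2 * ((2 * d + 1) / Suc m) + 2 * ((2 * d + 1) / Suc n)" for m n
  proof -
    have mid: "(1/2) *\<^sub>R (u m + u n) \<in> V"
      by (intro subspace_scale subspace_add V uV)
    have "(norm (u m - u n))\<^sup>2 + 4 * (norm (x - (1/2) *\<^sub>R (u m + u n)))\<^sup>2
        = 2 * (norm (x - u m))\<^sup>2 + 2 * (norm (x - u n))\<^sup>2"
      by (simp add: power2_norm_eq_inner inner_diff_left inner_diff_right inner_add_left
          inner_add_right inner_commute algebra_simps)
    moreover have "d\<^sup>2 \<le> (norm (x - (1/2) *\<^sub>R (u m + u n)))\<^sup>2"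
      using lower[OF mid] d0 by (intro power_mono) auto
    ultimately show ?thesis using sq[of m] sq[of n] by linarith
  qed
  have "Cauchy u"
  proof (rule metric_CauchyI)
    fix e :: real assume e: "0 < e"
    obtain N :: nat where N: "4 * (2 * d + 1) / e\<^sup>2 < N" using reals_Archimedean2 by blast
    have bd: "2 * ((2 * d + 1) / Suc n) < e\<^sup>2 / 2" if "n \<ge> N" for n
    proof -
      have "4 * (2 * d + 1) / e\<^sup>2 < Suc n" using N that by linarith
      then show ?thesis using e by (simp add: field_simps)
    qed
    show "\<exists>M. \<forall>m\<ge>M. \<forall>n\<ge>M. dist (u m) (u n) < e"
    proof (intro exI allI impI)
      fix m n assume "N \<le> m" "N \<le> n"
      then have "(norm (u m - u n))\<^sup>2 < e\<^sup>2" using par[of m n] bd[of m] bd[of n] by linarith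
      then show "dist (u m) (u n) < e" using e by (simp add: dist_norm power2_less_imp_less)
    qed
  qed
  then obtain v where v: "u \<longlonglongrightarrow> v" using Cauchy_convergent convergent_def by blast
  have vV: "v \<in> V" using closed_sequentially[OF V(2) _ v] uV by blast
  have "norm (x - v) \<le> d"
  proof (rule LIMSEQ_le)
    show "(\<lambda>n. norm (x - u n)) \<longlonglongrightarrow> norm (x - v)" by (intro tendsto_intros v)
    show "(\<lambda>n. d + 1 / Suc n) \<longlonglongrightarrow> d"
      using tendsto_add[OF tendsto_const[of d] LIMSEQ_inverse_real_of_nat]
      by (simp add: inverse_eq_divide)
    show "\<exists>N. \<forall>n\<ge>N. norm (x - u n) \<le> d + 1 / Suc n"
      using ud by (auto simp: dist_norm intro: less_imp_le)
  qed
  then have dv: "norm (x - v) = d" using lower[OF vV] by simp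
  have "inner (x - v) w = 0" if w: "w \<in> V" for w
  proof (cases "w = 0")
    case False
    \<comment> \<open>The minimiser of \<open>norm (x - v - t *\<^sub>R w)\<close>; a nonzero value
      would beat the distance \<open>d\<close>.\<close>
    define t where "t = inner (x - v) w / inner w w"
    have ww: "inner w w > 0" using False by simp
    have "v + t *\<^sub>R w \<in> V" by (intro subspace_add subspace_scale V vV w)
    then have "(norm (x - v))\<^sup>2 \<le> (norm (x - (v + t *\<^sub>R w)))\<^sup>2"
      using lower dv by (intro power_mono) auto
    also have "\<dots> = (norm (x - v))\<^sup>2 - 2 * t * inner (x - v) w + t * t * inner w w"
      by (simp add: power2_norm_eq_inner inner_diff_left inner_diff_right inner_add_left
          inner_add_right inner_commute algebra_simps)
    finally have "0 \<le> - 2 * t * inner (x - v) w + t * t * inner w w" by simp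
    also have "\<dots> = - ((inner (x - v) w)\<^sup>2 / inner w w)"
      using ww by (simp add: t_def power2_eq_square field_simps)
    finally have "(inner (x - v) w)\<^sup>2 / inner w w \<le> 0" by simp
    then have "(inner (x - v) w)\<^sup>2 \<le> 0" using ww by (simp add: divide_le_0_iff)
    then show ?thesis by simp
  qed simp
  then show ?thesis using vV by blast
qed

text \<open>For nonzero \<open>f\<close> the kernel has codimension one; its normal \<open>z\<close>
  is the part of \<open>x0\<close> orthogonal to it, and the scalar is fixed by testing at
  \<open>z\<close>.\<close>

lemma riesz_representation:
  fixes f :: "'a::{real_inner,banach} \<Rightarrow> real"
  assumes f: "bounded_linear f"
  shows "\<exists>y. \<forall>x. f x = inner x y"
proof (cases "\<forall>x. f x = 0")
  case True
  then show ?thesis by (intro exI[of _ 0]) simp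
next
  case False
  then obtain x0 where x0: "f x0 \<noteq> 0" by blast
  interpret f: bounded_linear f by (rule f)
  define V where "V = {x. f x = 0}"
  have "subspace V" by (auto simp: V_def subspace_def f.add f.scaleR f.zero)
  moreover have "closed V"
    unfolding V_def by (intro closed_Collect_eq continuous_intros f.continuous_on)
  ultimately obtain v where v: "v \<in> V" "\<forall>w\<in>V. inner (x0 - v) w = 0"
    using orthogonal_projection_exists by blast
  define z where "z = x0 - v"
  have fz: "f z \<noteq> 0" using x0 v by (simp add: z_def V_def f.diff)
  then have z0: "z \<noteq> 0" using f.zero by auto
  have "f x = inner x ((f z / inner z z) *\<^sub>R z)" for x
  proof -
    have "f (x - (f x / f z) *\<^sub>R z) = 0" using fz by (simp add: f.diff f.scaleR)
    then have "inner z (x - (f x / f z) *\<^sub>R z) = 0" using v(2) by (simp add: z_def V_def)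
    then have "inner x z = (f x / f z) * inner z z" by (simp add: inner_diff_right inner_commute)
    then show ?thesis using fz z0 by simp
  qed
  then show ?thesis by blast
qed

text \<open>Damped iteration: solutions of \<open>S x = y\<close> are the fixed points of
  \<open>x - t *\<^sub>R (S x - y)\<close>, a contraction for suitable \<open>t\<close>.\<close>

lemma lax_milgram_bij:
  fixes S :: "'a::{real_inner,banach} \<Rightarrow> 'a"
  assumes S: "bounded_linear S" and a: "0 < a" and coercive: "\<And>x. a * inner x x \<le> inner (S x) x"
  shows "bij S"
proof -
  interpret S: bounded_linear S by (rule S)
  obtain K where K: "0 < K" "\<And>x. norm (S x) \<le> norm x * K" using S.pos_bounded by blast
  \<comment> \<open>Adding \<open>a\<close> makes \<open>L\<close> strictly larger than
    \<open>a\<close>, which keeps \<open>q\<close> nonnegative.\<close>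
  define L where "L = K + a"
  have L: "0 < L" "a < L" "\<And>x. norm (S x) \<le> L * norm x"
  proof -
    show "0 < L" "a < L" using K a by (auto simp: L_def)
    fix x :: 'a
    have "0 \<le> a * norm x" using a by simp
    then show "norm (S x) \<le> L * norm x"
      using K(2)[of x] unfolding L_def by (simp only: distrib_right mult.commute[of "norm x"])
  qed
  \<comment> \<open>This \<open>t\<close> minimises 1 - 2 t a + t^2 L^2, and \<open>q\<close> is the
    minimum.\<close>
  define t where "t = a / L\<^sup>2"
  define q where "q = 1 - a\<^sup>2 / L\<^sup>2"
  have t: "0 < t" using a L by (simp add: t_def)
  have "a\<^sup>2 < L\<^sup>2" using a L by (intro power_strict_mono) auto
  then have q: "0 \<le> q" "q < 1" using a L by (auto simp: q_def field_simps)
  have contr: "(norm (x - t *\<^sub>R S x))\<^sup>2 \<le> q * (norm x)\<^sup>2" for x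
  proof -
    have "(norm (x - t *\<^sub>R S x))\<^sup>2 = (norm x)\<^sup>2 - 2 * t * inner (S x) x + t\<^sup>2 * (norm (S x))\<^sup>2"
      unfolding power2_norm_eq_inner power2_eq_square[of t]
      by (simp add: inner_diff_left inner_diff_right inner_commute algebra_simps)
    also have "\<dots> \<le> (norm x)\<^sup>2 - 2 * t * (a * (norm x)\<^sup>2) + t\<^sup>2 * (L\<^sup>2 * (norm x)\<^sup>2)"
    proof (intro add_mono diff_mono mult_left_mono order_refl)
      show "a * (norm x)\<^sup>2 \<le> inner (S x) x" using coercive by (simp add: power2_norm_eq_inner)
      show "(norm (S x))\<^sup>2 \<le> L\<^sup>2 * (norm x)\<^sup>2"
        using power_mono[OF L(3)[of x], of 2] by (simp add: power_mult_distrib)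
    qed (use t in auto)
    also have "\<dots> = q * (norm x)\<^sup>2"
      using L(1) by (simp add: t_def q_def field_simps power2_eq_square)
    finally show ?thesis .
  qed
  have "\<exists>!x. S x = y" for y
  proof -
    define g where "g x = x - t *\<^sub>R (S x - y)" for x
    have "\<forall>u v. dist (g u) (g v) \<le> sqrt q * dist u v"
    proof (intro allI)
      fix u v
      have "g u - g v = (u - v) - t *\<^sub>R S (u - v)" by (simp add: g_def S.diff algebra_simps)
      then have "(dist (g u) (g v))\<^sup>2 \<le> q * (dist u v)\<^sup>2" using contr by (simp add: dist_norm)
      then have "sqrt ((dist (g u) (g v))\<^sup>2) \<le> sqrt (q * (dist u v)\<^sup>2)" by (rule real_sqrt_le_mono)
      then show "dist (g u) (g v) \<le> sqrt q * dist u v" by (simp add: real_sqrt_mult)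
    qed
    then have "\<exists>!x. g x = x" using q by (intro banach_fix_type[of "sqrt q"]) auto
    moreover have "g x = x \<longleftrightarrow> S x = y" for x using t by (simp add: g_def)
    ultimately show ?thesis by simp
  qed
  then show ?thesis by (simp add: bij_iff)
qed

text \<open>Banach-Steinhaus for the functionals \<open>inner _ y\<close>: the closed sets
  \<open>G n\<close> cover the space, so by Baire one of them contains a ball.\<close>

lemma uniform_boundedness_inner:
  fixes Y :: "'a::{real_inner,banach} set"
  assumes pw: "\<And>x. \<exists>K. \<forall>y\<in>Y. \<bar>inner x y\<bar> \<le> K"
  shows "bounded Y"
proof -
  define G where "G n = {x. \<forall>y\<in>Y. \<bar>inner x y\<bar> \<le> real n}" for n
  have G_closed: "closed (G n)" for n
  proof -
    have "G n = (\<Inter>y\<in>Y. {x. \<bar>inner x y\<bar> \<le> real n})" by (auto simp: G_def)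
    then show ?thesis by (auto intro!: closed_INT closed_Collect_le continuous_intros)
  qed
  have "(\<Union>n. G n) = UNIV"
  proof -
    have "\<exists>n. x \<in> G n" for x
    proof -
      obtain K where K: "\<forall>y\<in>Y. \<bar>inner x y\<bar> \<le> K" using pw by blast
      obtain n where "K \<le> real n" using real_arch_simple by blast
      then have "x \<in> G n" using K by (force simp: G_def)
      then show ?thesis ..
    qed
    then show ?thesis by blast
  qed
  have "\<exists>n. interior (G n) \<noteq> {}"
  proof (rule ccontr)
    assume "\<nexists>n. interior (G n) \<noteq> {}"
    then have "euclidean interior_of \<Union>(range G) = {}"
      using G_closed completely_metrizable_space_euclidean
      by (intro Baire_category_alt) auto
    then show False using \<open>(\<Union>n. G n) = UNIV\<close> by simp
  qed
  then obtain n x0 where "x0 \<in> interior (G n)" by blast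
  then obtain e where e: "0 < e" "cball x0 e \<subseteq> G n"
    by (auto simp: mem_interior_cball)
  show ?thesis unfolding bounded_iff
  proof (intro exI ballI)
    fix y assume y: "y \<in> Y"
    \<comment> \<open>Length at most \<open>e\<close> in the direction of \<open>y\<close>;
      subtracting the bounds at \<open>x0 + x\<close> and \<open>x0\<close> then controls
      \<open>e * norm y\<close>.\<close>
    define x where "x = (e / norm y) *\<^sub>R y"
    have "norm x \<le> e" using e by (simp add: x_def)
    then have "x0 + x \<in> G n" "x0 \<in> G n" using e by (auto simp: subset_iff dist_norm)
    then have "\<bar>inner (x0 + x) y\<bar> \<le> n" "\<bar>inner x0 y\<bar> \<le> n" using y by (auto simp: G_def)
    then have "inner x y \<le> 2 * n" by (simp add: inner_add_left)
    moreover have "inner x y = e * norm y"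
      by (cases "y = 0") (simp_all add: x_def dot_square_norm power2_eq_square)
    ultimately show "norm y \<le> 2 * n / e" using e by (simp add: field_simps)
  qed
qed

lemma isometry_inner:
  fixes f :: "'a::real_inner \<Rightarrow> 'b::real_inner"
  assumes f: "linear f" and iso: "\<And>x. norm (f x) = norm x"
  shows "inner (f x) (f y) = inner x y"
proof -
  have "(norm (f (x + y)))\<^sup>2 = (norm (x + y))\<^sup>2" by (simp add: iso)
  moreover have "inner (f z) (f z) = inner z z" for z
    using iso[of z] by (simp add: norm_eq_sqrt_inner)
  ultimately show ?thesis
    by (simp add: linear_add[OF f] power2_norm_eq_inner inner_add_left inner_add_right inner_commute)
qed

section \<open>Complex structure, adjoints and bounded operators\<close>

text \<open>The real product determines the complex one, so for complex linear operators and complex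
  subspaces it suffices to argue with \<open>inner\<close>.\<close>

lemma cinner_eq_Complex: "cinner x y = Complex (inner x y) (inner x (scaleC \<i> y))"
proof -
  have "cinner x (scaleC \<i> y) = - \<i> * cinner x y"
    by (metis cinner_commute cinner_scaleC_left complex_cnj_i complex_cnj_mult)
  then show ?thesis by (simp add: inner_eq_Re_cinner complex_eq_iff)
qed

lemma inner_scaleC_left: "inner (scaleC c x) y = inner x (scaleC (cnj c) y)"
proof -
  have "cinner x (scaleC (cnj c) y) = c * cinner x y"
    by (metis cinner_commute cinner_scaleC_left complex_cnj_cnj complex_cnj_mult)
  then show ?thesis by (simp add: inner_eq_Re_cinner cinner_scaleC_left)
qed

lemma norm_scaleC: "norm (scaleC c x) = norm c * norm x" for x :: "'h::chilbert"
proof -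
  have "inner (scaleC c x) (scaleC c x) = (norm c)\<^sup>2 * inner x x"
  proof -
    have "scaleC (cnj c) (scaleC c x) = (norm c)\<^sup>2 *\<^sub>R x"
      by (simp only: scaleC_scaleC scaleR_scaleC complex_norm_square mult.commute)
    then show ?thesis by (simp add: inner_scaleC_left)
  qed
  then show ?thesis by (simp add: norm_eq_sqrt_inner real_sqrt_mult)
qed

lemma bounded_linear_scaleC: "bounded_linear (scaleC c :: 'h::chilbert \<Rightarrow> 'h)"
proof (rule bounded_linear_intro[where K = "norm c"])
  fix x y :: 'h and r :: real
  show "scaleC c (x + y) = scaleC c x + scaleC c y" by (rule scaleC_add_right)
  show "scaleC c (r *\<^sub>R x) = r *\<^sub>R scaleC c x"
    by (simp add: scaleR_scaleC scaleC_scaleC mult.commute)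
  show "norm (scaleC c x) \<le> norm x * norm c" by (simp add: norm_scaleC)
qed

lemma scaleC_zero_right [simp]: "scaleC c (0 :: 'h::chilbert) = 0"
  and scaleC_diff_right: "scaleC c (x - y) = scaleC c x - scaleC c (y :: 'h)"
  by (rule linear_0 linear_diff bounded_linear.linear bounded_linear_scaleC)+

lemma scaleC_zero_left [simp]: "scaleC 0 (x :: 'h::chilbert) = 0"
  by (metis of_real_0 scaleR_scaleC scaleR_zero_left)

lemma scaleC_one [simp]: "scaleC 1 (x :: 'h::chilbert) = x"
  by (metis of_real_1 scaleR_scaleC scaleR_one)

lemma scaleC_minus_left: "scaleC (- c) (x :: 'h::chilbert) = - scaleC c x"
  using scaleR_scaleC[of "- 1" "scaleC c x"] by (simp add: scaleC_scaleC)

lemma scaleC_ii_ii [simp]: "scaleC \<i> (scaleC \<i> (x :: 'h::chilbert)) = - x"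
  using scaleR_scaleC[of "-1" x] by (simp add: scaleC_scaleC)

lemma cinner_eq_zero_of_csubspace:
  fixes x :: "'h::chilbert"
  assumes V: "\<And>c w. w \<in> V \<Longrightarrow> scaleC c w \<in> V"
  shows "(\<forall>w\<in>V. cinner x w = 0) \<longleftrightarrow> (\<forall>w\<in>V. inner x w = 0)"
  using V by (auto simp: cinner_eq_Complex complex_eq_iff)

section \<open>Bounded complex linear operators\<close>

lemma
  assumes "A \<in> bounded_ops"
  shows bounded_ops_bounded_linear: "bounded_linear A"
    and bounded_ops_linear: "linear A"
    and bounded_ops_scaleC: "A (scaleC c x) = scaleC c (A x)"
    and bounded_ops_scaleR: "A (r *\<^sub>R x) = r *\<^sub>R A x"
    and bounded_ops_add: "A (x + y) = A x + A y"
    and bounded_ops_diff: "A (x - y) = A x - A y"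
    and bounded_ops_zero: "A 0 = 0"
proof -
  show bl: "bounded_linear A" and "A (scaleC c x) = scaleC c (A x)"
    using assms by (auto simp: bounded_ops_def)
  show lin: "linear A" using bl by (rule bounded_linear.linear)
  show "A (r *\<^sub>R x) = r *\<^sub>R A x" "A (x + y) = A x + A y" "A (x - y) = A x - A y" "A 0 = 0"
    by (simp_all add: linear_scale[OF lin] linear_add[OF lin] linear_diff[OF lin]
        linear_0[OF lin])
qed

lemma bounded_opsI:
  fixes A :: "'h::chilbert \<Rightarrow> 'h"
  assumes "\<And>x y. A (x + y) = A x + A y" "\<And>c x. A (scaleC c x) = scaleC c (A x)"
    "\<And>x. norm (A x) \<le> K * norm x"
  shows "A \<in> bounded_ops"
  unfolding bounded_ops_def
  using assms by (auto simp: scaleR_scaleC mult.commute intro!: bounded_linear_intro[where K = K])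

lemma bounded_ops_tendsto:
  assumes "A \<in> bounded_ops" "(f \<longlongrightarrow> l) F"
  shows "((\<lambda>n. A (f n)) \<longlongrightarrow> A l) F"
  using bounded_linear.tendsto[OF bounded_ops_bounded_linear[OF assms(1)] assms(2)] .

lemma bounded_ops_id: "id \<in> bounded_ops"
  by (rule bounded_opsI[where K = 1]) auto

lemma bounded_ops_comp: "A \<in> bounded_ops \<Longrightarrow> B \<in> bounded_ops \<Longrightarrow> A \<circ> B \<in> bounded_ops"
  unfolding bounded_ops_def comp_def by (auto intro: bounded_linear_compose)

lemma bounded_ops_plus: "A \<in> bounded_ops \<Longrightarrow> B \<in> bounded_ops \<Longrightarrow> (\<lambda>x. A x + B x) \<in> bounded_ops"
  unfolding bounded_ops_def by (auto intro: bounded_linear_add simp: scaleC_add_right)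

lemma bounded_ops_smult: "A \<in> bounded_ops \<Longrightarrow> (\<lambda>x. scaleC c (A x)) \<in> bounded_ops"
  unfolding bounded_ops_def
  by (auto intro!: bounded_linear_compose[OF bounded_linear_scaleC] simp: scaleC_scaleC mult.commute)

lemma bounded_ops_pointwise_limit:
  fixes A :: "'h::chilbert \<Rightarrow> 'h"
  assumes F: "\<And>n::nat. F n \<in> bounded_ops" and lim: "\<And>x. (\<lambda>n. F n x) \<longlonglongrightarrow> A x"
    and bd: "\<And>n x. norm (F n x) \<le> K * norm x"
  shows "A \<in> bounded_ops"
proof (rule bounded_opsI[where K = K])
  fix x y c
  show "A (x + y) = A x + A y"
    using tendsto_add[OF lim[of x] lim[of y]] lim[of "x + y"]
    by (simp add: bounded_ops_add[OF F] LIMSEQ_unique)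
  show "A (scaleC c x) = scaleC c (A x)"
    using bounded_linear.tendsto[OF bounded_linear_scaleC lim[of x], of c] lim[of "scaleC c x"]
    by (simp add: bounded_ops_scaleC[OF F] LIMSEQ_unique)
  show "norm (A x) \<le> K * norm x"
    using tendsto_norm[OF lim[of x]] bd by (intro LIMSEQ_le_const2) auto
qed

text \<open>Bijectivity is Lax-Milgram; coercivity evaluated at \<open>inv S x\<close>, with
  Cauchy-Schwarz, bounds the inverse by \<open>1 / a\<close>.\<close>

lemma bij_bounded_ops_inv:
  fixes S :: "'h::chilbert \<Rightarrow> 'h"
  assumes S: "S \<in> bounded_ops" and a: "0 < a" and coercive: "\<And>x. a * inner x x \<le> inner (S x) x"
  shows "bij S" "inv S \<in> bounded_ops"
proof -
  show bij: "bij S" using lax_milgram_bij[OF bounded_ops_bounded_linear[OF S] a coercive] .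
  have SI: "S (inv S x) = x" for x using bij by (simp add: bij_is_surj surj_f_inv_f)
  have IS: "inv S (S x) = x" for x using bij by (simp add: bij_is_inj)
  show "inv S \<in> bounded_ops"
  proof (rule bounded_opsI[where K = "1 / a"])
    fix x y c
    show "inv S (x + y) = inv S x + inv S y"
      using IS[of "inv S x + inv S y"] by (simp add: bounded_ops_add[OF S] SI)
    show "inv S (scaleC c x) = scaleC c (inv S x)"
      using IS[of "scaleC c (inv S x)"] by (simp add: bounded_ops_scaleC[OF S] SI)
    have "a * (norm (inv S x))\<^sup>2 \<le> norm x * norm (inv S x)"
      using order_trans[OF coercive[of "inv S x"] Cauchy_Schwarz_ineq2[THEN order_trans[OF abs_ge_self]]]
      by (simp add: SI power2_norm_eq_inner)
    then have "a * norm (inv S x) \<le> norm x"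
      by (cases "inv S x = 0") (auto simp: power2_eq_square)
    then show "norm (inv S x) \<le> 1 / a * norm x" using a by (simp add: field_simps)
  qed
qed

text \<open>The real adjoint of a complex linear operator is its complex adjoint: replacing
  \<open>x\<close> by \<open>scaleC (- \<i>) x\<close> matches the imaginary parts.\<close>

lemma cadj_eqI:
  assumes A: "A \<in> bounded_ops" and B: "\<And>x y. inner (A x) y = inner x (B y)"
  shows "cadj A = B"
  unfolding cadj_def
proof (rule the_equality)
  have "inner (A x) (scaleC \<i> y) = inner x (scaleC \<i> (B y))" for x y
    using B[of "scaleC (- \<i>) x" y] by (simp only: bounded_ops_scaleC[OF A] inner_scaleC_left) simp
  then show "\<forall>x y. cinner (A x) y = cinner x (B y)"
    by (simp only: cinner_eq_Complex B simp_thms)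
  fix B' assume B': "\<forall>x y. cinner (A x) y = cinner x (B' y)"
  have "inner (B' y) x = inner (B y) x" for x y
    using B[of x y] B' unfolding inner_eq_Re_cinner[of "A x"]
    by (simp only: inner_commute[of _ x]) (simp only: inner_eq_Re_cinner)
  then have "B' y = B y" for y by (rule real_inner_eqI)
  then show "B' = B" by (rule ext)
qed

text \<open>Riesz gives \<open>B y\<close> for each \<open>y\<close>; the bound follows because the
  square of \<open>norm (B x)\<close> is \<open>inner (A (B x)) x\<close>.\<close>

lemma adjoint_exists:
  fixes A :: "'h::chilbert \<Rightarrow> 'h"
  assumes A: "A \<in> bounded_ops"
  shows "\<exists>B\<in>bounded_ops. \<forall>x y. inner (A x) y = inner x (B y)"
proof -
  have "\<exists>z. \<forall>x. inner (A x) y = inner x z" for y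
    by (intro riesz_representation bounded_linear_compose[OF bounded_linear_inner_left]
        bounded_ops_bounded_linear A)
  then obtain B where B: "\<And>x y. inner (A x) y = inner x (B y)" by metis
  obtain K where K: "0 \<le> K" "\<And>x. norm (A x) \<le> norm x * K"
    using bounded_linear.nonneg_bounded[OF bounded_ops_bounded_linear[OF A]] by blast
  have eqI: "u = v" if "\<And>x. inner x u = inner x v" for u v :: 'h
    by (rule real_inner_eqI) (metis that inner_commute)
  have "B \<in> bounded_ops"
  proof (rule bounded_opsI[where K = K])
    fix x y c
    show "B (x + y) = B x + B y" by (rule eqI) (simp add: inner_add_right flip: B)
    show "B (scaleC c x) = scaleC c (B x)"
    proof (rule eqI)
      fix z
      have "inner z (B (scaleC c x)) = inner (scaleC (cnj c) (A z)) x"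
        by (simp add: inner_scaleC_left flip: B)
      also have "\<dots> = inner z (scaleC c (B x))"
        by (simp add: bounded_ops_scaleC[OF A, symmetric] B inner_scaleC_left)
      finally show "inner z (B (scaleC c x)) = inner z (scaleC c (B x))" .
    qed
    have "norm (B x) * norm (B x) = inner (A (B x)) x"
      by (simp add: B dot_square_norm power2_eq_square)
    also have "\<dots> \<le> norm (A (B x)) * norm x" by (rule norm_cauchy_schwarz)
    also have "\<dots> \<le> norm (B x) * K * norm x" by (intro mult_right_mono K) auto
    finally show "norm (B x) \<le> K * norm x" using K by (cases "B x = 0") auto
  qed
  then show ?thesis using B by blast
qed

lemma cadj_inner:
  assumes "A \<in> bounded_ops"
  shows "inner (A x) y = inner x (cadj A y)"
  using adjoint_exists[OF assms] cadj_eqI[OF assms] by metis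

lemma cadj_inner_right:
  assumes "A \<in> bounded_ops"
  shows "inner x (A y) = inner (cadj A x) y"
  using cadj_inner[OF assms] by (metis inner_commute)

lemma cadj_bounded_ops: "A \<in> bounded_ops \<Longrightarrow> cadj A \<in> bounded_ops"
  using adjoint_exists cadj_eqI by metis

lemma cadj_cadj: "A \<in> bounded_ops \<Longrightarrow> cadj (cadj A) = A"
  by (intro cadj_eqI cadj_bounded_ops) (simp_all add: cadj_inner_right)

lemma cadj_comp:
  "A \<in> bounded_ops \<Longrightarrow> B \<in> bounded_ops \<Longrightarrow> cadj (A \<circ> B) = cadj B \<circ> cadj A"
  by (intro cadj_eqI bounded_ops_comp) (simp_all add: cadj_inner)

section \<open>Von Neumann algebras\<close>

lemma
  assumes "von_neumann_algebra M"
  shows vna_bounded_ops: "A \<in> M \<Longrightarrow> A \<in> bounded_ops"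
    and vna_cadj: "A \<in> M \<Longrightarrow> cadj A \<in> M"
  using assms by (auto simp: von_neumann_algebra_def)

lemma
  assumes "X \<in> commutant M"
  shows commutant_bounded_ops: "X \<in> bounded_ops"
    and commutantD: "B \<in> M \<Longrightarrow> X (B x) = B (X x)"
  using assms by (auto simp: commutant_def fun_eq_iff)

lemma vnaI:
  assumes M: "von_neumann_algebra M" and A: "A \<in> bounded_ops"
    and comm: "\<And>X x. X \<in> commutant M \<Longrightarrow> A (X x) = X (A x)"
  shows "A \<in> M"
proof -
  have "A \<in> commutant (commutant M)"
    using A comm by (auto simp: commutant_def[of "commutant M"])
  then show ?thesis using M by (simp add: von_neumann_algebra_def)
qed

lemma vna_id: "von_neumann_algebra M \<Longrightarrow> id \<in> M"
  by (rule vnaI) (auto intro: bounded_ops_id)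

lemma vna_comp: "von_neumann_algebra M \<Longrightarrow> A \<in> M \<Longrightarrow> B \<in> M \<Longrightarrow> A \<circ> B \<in> M"
  by (rule vnaI) (auto intro: bounded_ops_comp vna_bounded_ops simp: commutantD[of _ M, symmetric])

lemma vna_plus:
  assumes M: "von_neumann_algebra M" and "A \<in> M" "B \<in> M"
  shows "(\<lambda>x. A x + B x) \<in> M"
proof (rule vnaI[OF M])
  show "(\<lambda>x. A x + B x) \<in> bounded_ops" by (intro bounded_ops_plus vna_bounded_ops[OF M] assms)
  show "A (X x) + B (X x) = X (A x + B x)" if "X \<in> commutant M" for X x
    using assms by (simp add: bounded_ops_add[OF commutant_bounded_ops[OF that]] commutantD[OF that])
qed

lemma vna_smult:
  assumes M: "von_neumann_algebra M" and "A \<in> M"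
  shows "(\<lambda>x. scaleC c (A x)) \<in> M"
proof (rule vnaI[OF M])
  show "(\<lambda>x. scaleC c (A x)) \<in> bounded_ops" by (intro bounded_ops_smult vna_bounded_ops[OF M] assms)
  show "scaleC c (A (X x)) = X (scaleC c (A x))" if "X \<in> commutant M" for X x
    using assms by (simp add: bounded_ops_scaleC[OF commutant_bounded_ops[OF that]] commutantD[OF that])
qed

lemma diff_eq_plus_scaleC: "(\<lambda>x. A x - B x) = (\<lambda>x. A x + scaleC (- 1) (B x :: 'h::chilbert))"
  by (simp add: scaleC_minus_left)

lemma vna_diff:
  assumes "von_neumann_algebra M" "A \<in> M" "B \<in> M"
  shows "(\<lambda>x. A x - B x) \<in> M"
  unfolding diff_eq_plus_scaleC by (intro vna_plus vna_smult assms)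

lemma vna_funpow: "von_neumann_algebra M \<Longrightarrow> A \<in> M \<Longrightarrow> A ^^ n \<in> M"
  by (induction n) (auto intro: vna_id vna_comp)

text \<open>Commuting with a fixed bounded operator survives pointwise limits; this places the
  support, the square root and the quotient inside \<open>M\<close>.\<close>

lemma vna_pointwise_limit:
  fixes A :: "'h::chilbert \<Rightarrow> 'h"
  assumes M: "von_neumann_algebra M" and F: "\<And>n::nat. F n \<in> M"
    and lim: "\<And>x. (\<lambda>n. F n x) \<longlonglongrightarrow> A x" and bd: "\<And>n x. norm (F n x) \<le> K * norm x"
  shows "A \<in> M"
proof (rule vnaI[OF M])
  show "A \<in> bounded_ops"
    using vna_bounded_ops[OF M F] lim bd by (rule bounded_ops_pointwise_limit)
  fix X x assume X: "X \<in> commutant M"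
  have "(\<lambda>n. X (F n x)) \<longlonglongrightarrow> X (A x)"
    using commutant_bounded_ops[OF X] lim by (rule bounded_ops_tendsto)
  then show "A (X x) = X (A x)"
    using lim[of "X x"] by (simp add: commutantD[OF X F] LIMSEQ_unique)
qed

section \<open>Unitaries of the commutant detect membership\<close>

lemma commutant_cadj:
  assumes M: "von_neumann_algebra M" and X: "X \<in> commutant M"
  shows "cadj X \<in> commutant M"
proof -
  have Xb: "X \<in> bounded_ops" using X by (rule commutant_bounded_ops)
  have "cadj X \<circ> B = B \<circ> cadj X" if B: "B \<in> M" for B
  proof -
    have Bb: "B \<in> bounded_ops" "cadj B \<in> bounded_ops"
      using vna_bounded_ops[OF M] vna_cadj[OF M] B by blast+
    have "cadj B \<circ> X = X \<circ> cadj B"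
      using commutantD[OF X vna_cadj[OF M B]] by (simp add: fun_eq_iff)
    then have "cadj (cadj B \<circ> X) = cadj (X \<circ> cadj B)" by simp
    then show ?thesis using Xb Bb by (simp add: cadj_comp cadj_cadj)
  qed
  then show ?thesis using Xb by (simp add: commutant_def cadj_bounded_ops)
qed

text \<open>For self-adjoint \<open>X\<close> the number \<open>cinner (X x) x\<close> is real, so
  multiplication by \<open>\<i>\<close> leaves no real part.\<close>

lemma inner_scaleC_ii_selfadj:
  assumes X: "X \<in> bounded_ops" and sa: "\<And>x y. inner (X x) y = inner x (X y)"
  shows "inner (scaleC \<i> (X x)) x = 0"
proof -
  have "inner (scaleC \<i> (X x)) x = inner x (X (scaleC (- \<i>) x))"
    by (simp add: inner_scaleC_left sa)
  also have "\<dots> = inner (scaleC \<i> x) (X x)"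
    by (simp add: bounded_ops_scaleC[OF X] inner_scaleC_left)
  finally show ?thesis
    using inner_commute[of "scaleC \<i> x" "X x"]
    by (simp add: inner_scaleC_left[of \<i> "X x"] scaleC_minus_left)
qed

text \<open>An operator commuting with the Cayley transform \<open>(1 - iX)(1 + iX)\<^sup>-\<^sup>1\<close> of a self-adjoint
  \<open>X\<close> commutes with \<open>X\<close>; this makes the unitaries of the commutant as good as the whole
  commutant.\<close>

lemma commutes_selfadj_if_commutes_unitary:
  assumes M: "von_neumann_algebra M" and A: "A \<in> bounded_ops"
    and comm: "\<And>U x. U \<in> commutant M \<Longrightarrow> unitary_op U \<Longrightarrow> A (U x) = U (A x)"
    and XM: "X \<in> commutant M" and sa: "\<And>x y. inner (X x) y = inner x (X y)"
  shows "A (X x) = X (A x)"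
proof -
  have X: "X \<in> bounded_ops" using XM by (rule commutant_bounded_ops)
  define J where "J x = x + scaleC \<i> (X x)" for x
  define J' where "J' x = x + scaleC (- \<i>) (X x)" for x
  note m = scaleC_minus_left
  have J: "J \<in> bounded_ops"
    using bounded_ops_plus[OF bounded_ops_id bounded_ops_smult[OF X], of \<i>]
    by (simp add: J_def[abs_def])
  have J': "J' \<in> bounded_ops"
    using bounded_ops_plus[OF bounded_ops_id bounded_ops_smult[OF X], of "- \<i>"]
    by (simp add: J'_def[abs_def])
  have z: "inner (scaleC \<i> (X x)) x = 0" for x by (rule inner_scaleC_ii_selfadj[OF X sa])
  \<comment> \<open>The cross term has real part zero, so \<open>J\<close>, and likewise
    \<open>J'\<close>, is coercive with constant 1 and hence invertible.\<close>
  have "1 * inner x x \<le> inner (J x) x" for x by (simp add: J_def inner_add_left z)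
  note bijJ = bij_bounded_ops_inv[OF J zero_less_one this]
  have "1 * inner x x \<le> inner (J' x) x" for x by (simp add: J'_def inner_add_left inner_diff_left m z)
  note bijJ' = bij_bounded_ops_inv[OF J' zero_less_one this]
  have JI: "J (inv J x) = x" for x using bijJ by (simp add: bij_is_surj surj_f_inv_f)
  have IJ: "inv J (J x) = x" for x using bijJ by (simp add: bij_is_inj)
  define U where "U x = J' (inv J x)" for x
  \<comment> \<open>In this form, commuting with \<open>U\<close> amounts to commuting with
    \<open>inv J\<close>.\<close>
  have U_alt: "U x = scaleC 2 (inv J x) - x" for x
  proof -
    have "scaleC 2 y = y + y" for y :: 'a
      using scaleC_add_left[of 1 1 y] by simp
    moreover have "J' y = (y + y) - J y" for y by (simp add: J_def J'_def m)
    ultimately show ?thesis by (simp add: U_def JI)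
  qed
  have U: "U \<in> bounded_ops"
    using bounded_ops_comp[OF J' bijJ(2)] by (simp add: U_def[abs_def] comp_def)
  have iso: "norm (U x) = norm x" for x
  proof -
    have "norm (J' y) = norm (J y)" for y
      using z[of y] by (simp add: norm_eq_sqrt_inner J_def J'_def m inner_add_left inner_add_right
          inner_diff_left inner_diff_right inner_commute)
    then show ?thesis by (simp add: U_def JI)
  qed
  have UI: "inner (U x) (U y) = inner x y" for x y
    using isometry_inner[OF bounded_ops_linear[OF U] iso] .
  have UU: "cadj U (U x) = x" for x
    by (rule real_inner_eqI) (metis UI U cadj_inner_right inner_commute)
  have "surj U" unfolding surj_def
  proof
    fix y
    obtain w where "y = J' w" using bijJ'(1) by (metis bij_pointE)
    then have "y = U (J w)" by (simp add: U_def IJ)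
    then show "\<exists>x. y = U x" ..
  qed
  then have "U (cadj U x) = x" for x by (metis UU surj_def)
  then have unit: "unitary_op U" using U UU by (auto simp: unitary_op_def)
  have "inv J (B y) = B (inv J y)" if "B \<in> M" for B y
  proof -
    have Bb: "B \<in> bounded_ops" using M that by (rule vna_bounded_ops)
    have "J (B (inv J y)) = B (J (inv J y))"
      using commutantD[OF XM that] by (simp add: J_def bounded_ops_add[OF Bb] bounded_ops_scaleC[OF Bb])
    then show ?thesis by (metis IJ JI)
  qed
  then have "U \<in> commutant M"
    using U vna_bounded_ops[OF M]
    by (auto simp: commutant_def U_alt fun_eq_iff bounded_ops_diff bounded_ops_scaleC)
  then have AU: "A (U x) = U (A x)" for x using unit by (rule comm)
  have AI: "A (inv J x) = inv J (A x)" for x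
  proof -
    have "scaleC 2 (A (inv J x)) = scaleC 2 (inv J (A x))"
      using AU[of x] by (simp add: U_alt bounded_ops_diff[OF A] bounded_ops_scaleC[OF A])
    then have "scaleC (1/2) (scaleC 2 (A (inv J x))) = scaleC (1/2) (scaleC 2 (inv J (A x)))" by simp
    then show ?thesis by (simp add: scaleC_scaleC)
  qed
  have "A (J x) = J (A x)" by (metis AI IJ JI)
  then have "scaleC \<i> (A (X x)) = scaleC \<i> (X (A x))"
    by (simp add: J_def bounded_ops_add[OF A] bounded_ops_scaleC[OF A])
  then have "scaleC \<i> (scaleC \<i> (A (X x))) = scaleC \<i> (scaleC \<i> (X (A x)))" by simp
  then show ?thesis by simp
qed

text \<open>Affiliation speaks of unitaries, so the bicommutant test is reduced to them: an element
  of the commutant splits into self-adjoint parts, again in the commutant, and each is handled by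
  its Cayley transform.\<close>

lemma vnaI_unitary:
  assumes M: "von_neumann_algebra M" and A: "A \<in> bounded_ops"
    and comm: "\<And>U x. U \<in> commutant M \<Longrightarrow> unitary_op U \<Longrightarrow> A (U x) = U (A x)"
  shows "A \<in> M"
proof (rule vnaI[OF M A])
  fix X x assume XM: "X \<in> commutant M"
  have X: "X \<in> bounded_ops" "cadj X \<in> bounded_ops"
    using commutant_bounded_ops[OF XM] cadj_bounded_ops by auto
  \<comment> \<open>\<open>H\<close> is twice the real part of \<open>X\<close>, and
    \<open>K\<close> is minus twice its imaginary part.\<close>
  define H where "H x = X x + cadj X x" for x
  define K where "K x = scaleC \<i> (X x - cadj X x)" for x
  have comm_plus: "(\<lambda>x. P x + Q x) \<in> commutant M"
    if "P \<in> commutant M" "Q \<in> commutant M" for P Q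
    using that by (auto simp: commutant_def fun_eq_iff bounded_ops_plus
        bounded_ops_add[OF vna_bounded_ops[OF M]])
  have comm_smult: "(\<lambda>x. scaleC c (P x)) \<in> commutant M" if "P \<in> commutant M" for P c
    using that by (auto simp: commutant_def fun_eq_iff bounded_ops_smult
        bounded_ops_scaleC[OF vna_bounded_ops[OF M]])
  have HM: "H \<in> commutant M"
    using comm_plus[OF XM commutant_cadj[OF M XM]] by (simp add: H_def[abs_def])
  have "(\<lambda>x. X x - cadj X x) \<in> commutant M"
    unfolding diff_eq_plus_scaleC by (intro comm_plus comm_smult XM commutant_cadj[OF M])
  then have KM: "K \<in> commutant M" unfolding K_def[abs_def] by (rule comm_smult)
  have Hsa: "inner (H x) y = inner x (H y)" for x y
    by (simp add: H_def inner_add_left inner_add_right cadj_inner[OF X(1)] cadj_inner_right[OF X(1)])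
  have Ksa: "inner (K x) y = inner x (K y)" for x y
  proof -
    have "inner (K x) y = inner (X x - cadj X x) (scaleC (- \<i>) y)"
      by (simp add: K_def inner_scaleC_left)
    also have "\<dots> = inner x (cadj X (scaleC (- \<i>) y)) - inner x (X (scaleC (- \<i>) y))"
      by (simp add: inner_diff_left cadj_inner[OF X(1)] cadj_inner_right[OF X(1)])
    also have "\<dots> = inner x (scaleC (- \<i>) (cadj X y - X y))"
      by (simp add: bounded_ops_scaleC[OF X(1)] bounded_ops_scaleC[OF X(2)] scaleC_diff_right
          inner_diff_right)
    also have "scaleC (- \<i>) (cadj X y - X y) = K y"
      by (simp add: K_def scaleC_minus_left scaleC_diff_right)
    finally show ?thesis .
  qed
  have AH: "A (H x) = H (A x)" for x
    by (rule commutes_selfadj_if_commutes_unitary[OF M A comm HM Hsa])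
  have AK: "A (K x) = K (A x)" for x
    by (rule commutes_selfadj_if_commutes_unitary[OF M A comm KM Ksa])
  have dec: "X x = scaleC (1/2) (H x - scaleC \<i> (K x))" for x
  proof -
    have "H x - scaleC \<i> (K x) = X x + X x" by (simp add: H_def K_def)
    also have "\<dots> = scaleC 2 (X x)" using scaleC_add_left[of 1 1 "X x"] by simp
    finally show ?thesis by (simp add: scaleC_scaleC)
  qed
  show "A (X x) = X (A x)"
    by (simp add: dec bounded_ops_scaleC[OF A] bounded_ops_diff[OF A] AH AK)
qed

section \<open>Positive contractions\<close>

text \<open>The order interval from 0 to 1. It is stable under passing to 1 - C, whose powers
  produce both the support and the square root.\<close>

definition pos_contr :: "('h::chilbert \<Rightarrow> 'h) \<Rightarrow> bool" where
  "pos_contr C \<longleftrightarrow> C \<in> bounded_ops \<and> (\<forall>x y. inner (C x) y = inner x (C y)) \<and>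
     (\<forall>x. 0 \<le> inner (C x) x \<and> inner (C x) x \<le> inner x x)"

lemma
  assumes "pos_contr C"
  shows pos_contr_bounded_ops: "C \<in> bounded_ops"
    and pos_contr_selfadj: "inner (C x) y = inner x (C y)"
    and pos_contr_nonneg: "0 \<le> inner (C x) x"
    and pos_contr_le: "inner (C x) x \<le> inner x x"
  using assms by (auto simp: pos_contr_def)

lemma pos_contr_cadj: "pos_contr C \<Longrightarrow> cadj C = C"
  by (intro cadj_eqI pos_contr_bounded_ops pos_contr_selfadj)

lemma pos_contr_compl:
  assumes "pos_contr C"
  shows "pos_contr (\<lambda>x. x - C x)"
proof -
  have "(\<lambda>x. id x + scaleC (- 1) (C x)) \<in> bounded_ops"
    by (intro bounded_ops_plus bounded_ops_smult bounded_ops_id pos_contr_bounded_ops assms)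
  then show ?thesis
    using pos_contr_nonneg[OF assms] pos_contr_le[OF assms]
    by (auto simp: pos_contr_def scaleC_minus_left inner_diff_left inner_diff_right
        pos_contr_selfadj[OF assms])
qed

text \<open>\<open>C - C\<^sup>2 = C (1 - C) C + (1 - C) C (1 - C) \<ge> 0\<close>.\<close>

lemma pos_contr_square_le:
  assumes C: "pos_contr C"
  shows "inner (C x) (C x) \<le> inner (C x) x"
proof -
  have "0 \<le> inner (C x - C (C x)) (C x) + inner (C (x - C x)) (x - C x)"
    using pos_contr_le[OF C, of "C x"] pos_contr_nonneg[OF C, of "x - C x"]
    by (simp add: inner_diff_left)
  also have "\<dots> = inner (C x) x - inner (C x) (C x)"
    by (simp add: bounded_ops_diff[OF pos_contr_bounded_ops[OF C]] inner_diff_left inner_diff_right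
        pos_contr_selfadj[OF C])
  finally show ?thesis by simp
qed

lemma pos_contr_norm:
  assumes "pos_contr C"
  shows "norm (C x) \<le> norm x"
proof -
  have "inner (C x) (C x) \<le> inner x x"
    using pos_contr_square_le[OF assms, of x] pos_contr_le[OF assms, of x] by linarith
  then show ?thesis by (simp add: norm_eq_sqrt_inner)
qed

section \<open>Powers of a positive contraction and their limit\<close>

context
  fixes C :: "'h::chilbert \<Rightarrow> 'h"
  assumes C: "pos_contr C"
begin

lemma pos_contr_funpow_bounded_ops: "C ^^ n \<in> bounded_ops"
  by (induction n)
    (simp_all only: funpow.simps bounded_ops_id bounded_ops_comp pos_contr_bounded_ops[OF C])

lemma pos_contr_funpow_selfadj: "inner ((C ^^ n) x) y = inner x ((C ^^ n) y)"
  by (induction n arbitrary: x y) (simp_all add: pos_contr_selfadj[OF C] funpow_swap1)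

lemma pos_contr_funpow_norm: "norm ((C ^^ n) x) \<le> norm x"
  by (induction n) (auto intro: order_trans pos_contr_norm[OF C])

lemma pos_contr_funpow_inner: "inner ((C ^^ m) x) ((C ^^ n) y) = inner ((C ^^ (m + n)) x) y"
proof -
  have "inner ((C ^^ m) x) ((C ^^ n) y) = inner ((C ^^ n) ((C ^^ m) x)) y"
    by (simp add: pos_contr_funpow_selfadj)
  then show ?thesis by (simp add: add.commute[of m] funpow_add)
qed

text \<open>Half of the power moves to the other argument; an odd power leaves a single
  \<open>C\<close> between two equal vectors.\<close>

lemma pos_contr_funpow_nonneg: "0 \<le> inner ((C ^^ n) x) x"
proof (cases "even n")
  case True
  then obtain k where "n = k + k" by (metis evenE mult_2)
  then show ?thesis using pos_contr_funpow_inner[of k x k x] by (metis inner_ge_zero)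
next
  case False
  then obtain k where "n = Suc k + k" by (metis oddE mult_2 add_Suc Suc_eq_plus1)
  then show ?thesis
    using pos_contr_nonneg[OF C, of "(C ^^ k) x"] pos_contr_funpow_inner[of "Suc k" x k x] by simp
qed

text \<open>At the vector \<open>(C ^^ k) x\<close>, the even case is C \<le> 1 and the odd case is
  C^2 \<le> C.\<close>

lemma pos_contr_funpow_antimono: "inner ((C ^^ Suc n) x) x \<le> inner ((C ^^ n) x) x"
proof (cases "even n")
  case True
  then obtain k where n: "n = k + k" by (metis evenE mult_2)
  then show ?thesis
    using pos_contr_le[OF C, of "(C ^^ k) x"] pos_contr_funpow_inner[of k x k x]
      pos_contr_funpow_inner[of "Suc k" x k x] by simp
next
  case False
  then obtain k where n: "n = Suc k + k" by (metis oddE mult_2 add_Suc Suc_eq_plus1)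
  then show ?thesis
    using pos_contr_square_le[OF C, of "(C ^^ k) x"] pos_contr_funpow_inner[of "Suc k" x k x]
      pos_contr_funpow_inner[of "Suc k" x "Suc k" x] by simp
qed

text \<open>The quadratic forms decrease and converge; squared distances between orbit points are
  combinations of them, so the orbit is Cauchy.\<close>

lemma pos_contr_funpow_convergent: "convergent (\<lambda>n. (C ^^ n) x)"
proof -
  define a where "a n = inner ((C ^^ n) x) x" for n
  have "decseq a" unfolding a_def by (intro decseq_SucI pos_contr_funpow_antimono)
  then obtain l where l: "a \<longlonglongrightarrow> l"
    by (rule decseq_convergent[where B = 0]) (auto simp: a_def pos_contr_funpow_nonneg)
  have dist: "(dist ((C ^^ m) x) ((C ^^ n) x))\<^sup>2 = a (m + m) - 2 * a (m + n) + a (n + n)" for m n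
    by (simp add: dist_norm power2_norm_eq_inner inner_diff_left inner_diff_right
        pos_contr_funpow_inner a_def add.commute[of n m])
  have "Cauchy (\<lambda>n. (C ^^ n) x)"
  proof (rule metric_CauchyI)
    fix e :: real assume "0 < e"
    \<comment> \<open>The coefficients 1, -2, 1 in \<open>dist\<close> cancel the limit
      \<open>l\<close>, and their absolute values add up to 4.\<close>
    then obtain N where N: "\<And>n. n \<ge> N \<Longrightarrow> \<bar>a n - l\<bar> < e\<^sup>2 / 4"
      using LIMSEQ_D[OF l, of "e\<^sup>2 / 4"] by auto
    show "\<exists>N. \<forall>m\<ge>N. \<forall>n\<ge>N. dist ((C ^^ m) x) ((C ^^ n) x) < e"
    proof (intro exI allI impI)
      fix m n assume "N \<le> m" "N \<le> n"
      then have "\<bar>a (m + m) - l\<bar> < e\<^sup>2 / 4" "\<bar>a (m + n) - l\<bar> < e\<^sup>2 / 4" "\<bar>a (n + n) - l\<bar> < e\<^sup>2 / 4"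
        by - (rule N, simp)+
      then have "(dist ((C ^^ m) x) ((C ^^ n) x))\<^sup>2 < e\<^sup>2" unfolding dist by linarith
      then show "dist ((C ^^ m) x) ((C ^^ n) x) < e" using \<open>0 < e\<close> by (simp add: power2_less_imp_less)
    qed
  qed
  then show ?thesis by (rule Cauchy_convergent)
qed

end

subsection \<open>The support projection\<close>

text \<open>For a positive contraction \<open>B\<close> the powers of 1 - B tend to the projection
  onto the kernel of \<open>B\<close>, so this is the support projection. As a limit of polynomials
  in \<open>B\<close> it stays in \<open>M\<close> and can be followed through a
  homomorphism.\<close>

definition supp :: "('h::chilbert \<Rightarrow> 'h) \<Rightarrow> ('h \<Rightarrow> 'h)" where
  "supp B x = x - lim (\<lambda>n. ((\<lambda>y. y - B y) ^^ n) x)"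

context
  fixes B :: "'h::chilbert \<Rightarrow> 'h"
  assumes B: "pos_contr B"
begin

private abbreviation "C \<equiv> \<lambda>y. y - B y"

lemma supp_lim: "(\<lambda>n. x - (C ^^ n) x) \<longlonglongrightarrow> supp B x"
  unfolding supp_def
  using pos_contr_funpow_convergent[OF pos_contr_compl[OF B]]
  by (intro tendsto_diff tendsto_const) (simp add: convergent_LIMSEQ_iff)

lemma supp_of_null: "B x = 0 \<Longrightarrow> supp B x = 0"
proof -
  assume "B x = 0"
  then have "(C ^^ n) x = x" for n by (induction n) auto
  then show ?thesis using supp_lim[of x] by (simp add: LIMSEQ_const_iff)
qed

text \<open>The limit of the powers is fixed by 1 - B, that is, killed by \<open>B\<close>.\<close>

lemma comp_supp: "B (supp B x) = B x"
proof -
  have "(\<lambda>n. (C ^^ n) x) \<longlonglongrightarrow> x - supp B x"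
    using tendsto_diff[OF tendsto_const[of x] supp_lim[of x]] by simp
  then have 1: "(\<lambda>n. C ((C ^^ n) x)) \<longlonglongrightarrow> C (x - supp B x)" and
    2: "(\<lambda>n. (C ^^ Suc n) x) \<longlonglongrightarrow> x - supp B x"
    by (rule bounded_ops_tendsto[OF pos_contr_bounded_ops[OF pos_contr_compl[OF B]]], rule LIMSEQ_Suc)
  have "C (x - supp B x) = x - supp B x" using LIMSEQ_unique[OF 1] 2 by simp
  then show ?thesis by (simp add: bounded_ops_diff[OF pos_contr_bounded_ops[OF B]])
qed

lemma norm_diff_funpow_le: "norm (x - (C ^^ n) x) \<le> 2 * norm x"
  using norm_triangle_ineq4[of x "(C ^^ n) x"] pos_contr_funpow_norm[OF pos_contr_compl[OF B], of n x]
  by linarith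

lemma supp_vna:
  assumes M: "von_neumann_algebra M" and BM: "B \<in> M"
  shows "supp B \<in> M"
proof (rule vna_pointwise_limit[OF M _ supp_lim norm_diff_funpow_le])
  have C: "C \<in> M" using vna_diff[OF M vna_id[OF M] BM] by simp
  show "(\<lambda>x. x - (C ^^ n) x) \<in> M" for n
    using vna_diff[OF M vna_id[OF M] vna_funpow[OF M C, of n]] by simp
qed

lemma supp_bounded_ops: "supp B \<in> bounded_ops"
proof (rule bounded_ops_pointwise_limit[OF _ supp_lim norm_diff_funpow_le])
  show "(\<lambda>x. x - (C ^^ n) x) \<in> bounded_ops" for n
    using bounded_ops_plus[OF bounded_ops_id
        bounded_ops_smult[OF pos_contr_funpow_bounded_ops[OF pos_contr_compl[OF B]], of "- 1"]]
    by (simp add: scaleC_minus_left)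
qed

lemma supp_selfadj: "inner (supp B x) y = inner x (supp B y)"
proof (rule LIMSEQ_unique)
  show "(\<lambda>n. inner (x - (C ^^ n) x) y) \<longlonglongrightarrow> inner (supp B x) y"
    by (intro tendsto_inner supp_lim tendsto_const)
  have "inner (x - (C ^^ n) x) y = inner x (y - (C ^^ n) y)" for n
    by (simp add: inner_diff_left inner_diff_right pos_contr_funpow_selfadj[OF pos_contr_compl[OF B]])
  then show "(\<lambda>n. inner (x - (C ^^ n) x) y) \<longlonglongrightarrow> inner x (supp B y)"
    by (simp add: tendsto_inner[OF tendsto_const supp_lim])
qed

lemma supp_supp: "supp B (supp B x) = supp B x"
proof -
  have "supp B (x - supp B x) = 0"
    by (rule supp_of_null) (simp add: comp_supp bounded_ops_diff[OF pos_contr_bounded_ops[OF B]])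
  then show ?thesis by (simp add: bounded_ops_diff[OF supp_bounded_ops])
qed

text \<open>The Neumann sums, which in the limit invert \<open>B\<close> on its range.\<close>

lemma diff_funpow_eq:
  shows "x - (C ^^ n) x = B (\<Sum>k<n. (C ^^ k) x)"
    and "B (\<Sum>k<n. (C ^^ k) x) = (\<Sum>k<n. (C ^^ k) (B x))"
proof -
  have lin: "linear B" using bounded_ops_linear[OF pos_contr_bounded_ops[OF B]] .
  show "x - (C ^^ n) x = B (\<Sum>k<n. (C ^^ k) x)"
    by (induction n) (simp_all add: linear_0[OF lin] linear_add[OF lin] algebra_simps)
  have "B ((C ^^ k) x) = (C ^^ k) (B x)" for k
    by (induction k) (simp_all add: linear_diff[OF lin])
  then show "B (\<Sum>k<n. (C ^^ k) x) = (\<Sum>k<n. (C ^^ k) (B x))"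
    by (simp add: linear_sum[OF lin])
qed

end

subsection \<open>Square roots\<close>

text \<open>The coefficients of the power series of \<open>sqrt (1 - z)\<close>.\<close>

definition sqrt_coeff :: "nat \<Rightarrow> real" where
  "sqrt_coeff n = (- 1) ^ n * ((1/2) gchoose n)"

lemma sqrt_coeff_0 [simp]: "sqrt_coeff 0 = 1"
  by (simp add: sqrt_coeff_def)

text \<open>Written as a rising factorial of -1/2, the coefficient has a single negative factor,
  -1/2 itself.\<close>

lemma sqrt_coeff_Suc_nonpos: "sqrt_coeff (Suc n) \<le> 0"
proof -
  have "(-1) ^ n * (-1) ^ n = (1::real)" by (simp flip: power_mult_distrib)
  then have "sqrt_coeff (Suc n) = pochhammer (- (1/2)) (Suc n) / fact (Suc n)"
    by (simp add: sqrt_coeff_def gbinomial_pochhammer)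
  also have "\<dots> = - (1/2) * pochhammer (1/2) n / fact (Suc n)"
    by (simp add: pochhammer_rec)
  also have "\<dots> \<le> 0" by (simp add: pochhammer_nonneg)
  finally show ?thesis .
qed

text \<open>Partial sums are the coefficients of sqrt (1 - z) / (1 - z), that is, of (1 - z)^(-1/2),
  which are positive.\<close>

lemma sqrt_coeff_partial_sum_nonneg: "0 \<le> (\<Sum>k\<le>n. sqrt_coeff k)"
proof -
  have "(-1) ^ n * (-1) ^ n = (1::real)" by (simp flip: power_mult_distrib)
  moreover have "(\<Sum>k\<le>n. sqrt_coeff k) = (- 1) ^ n * ((1/2 - 1) gchoose n)"
    using gbinomial_sum_lower_neg[of "1/2 :: real" n] by (simp add: sqrt_coeff_def mult.commute)
  ultimately have "(\<Sum>k\<le>n. sqrt_coeff k) = pochhammer (1/2) n / fact n"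
    by (simp add: gbinomial_pochhammer)
  then show ?thesis by (simp add: pochhammer_nonneg)
qed

lemma sqrt_coeff_abs_sum_le: "(\<Sum>k<n. \<bar>sqrt_coeff k\<bar>) \<le> 2"
proof -
  \<comment> \<open>Only the coefficient of index 0, equal to 1, is positive; reversing the signs of
    the others turns a sum s into 2 - s, the origin of the constant 2.\<close>
  have "(\<Sum>k\<le>m. \<bar>sqrt_coeff k\<bar>) = 2 - (\<Sum>k\<le>m. sqrt_coeff k)" for m
    by (induction m) (use sqrt_coeff_Suc_nonpos in \<open>auto simp: abs_of_nonpos\<close>)
  then show ?thesis
    by (cases n) (use sqrt_coeff_partial_sum_nonneg in \<open>auto simp: lessThan_Suc_atMost\<close>)
qed

lemma summable_abs_sqrt_coeff: "summable (\<lambda>n. \<bar>sqrt_coeff n\<bar>)"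
  by (rule summableI_nonneg_bounded[where x = 2]) (auto simp: sqrt_coeff_abs_sum_le)

text \<open>Squaring the series gives 1 - z; for the coefficients this is Vandermonde with 1/2 + 1/2
  = 1.\<close>

lemma sqrt_coeff_convolution:
  "(\<Sum>k\<le>n. sqrt_coeff k * sqrt_coeff (n - k)) = (if n = 0 then 1 else if n = 1 then - 1 else 0)"
proof -
  have "(\<Sum>k\<le>n. sqrt_coeff k * sqrt_coeff (n - k))
      = (\<Sum>k\<le>n. (- 1) ^ n * (((1/2) gchoose k) * ((1/2) gchoose (n - k))))"
  proof (rule sum.cong)
    fix k assume "k \<in> {..n}"
    then have "(- 1 :: real) ^ n = (- 1) ^ k * (- 1) ^ (n - k)" by (simp flip: power_add)
    then show "sqrt_coeff k * sqrt_coeff (n - k)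
        = (- 1) ^ n * (((1/2) gchoose k) * ((1/2) gchoose (n - k)))"
      by (simp add: sqrt_coeff_def)
  qed simp
  also have "\<dots> = (- 1) ^ n * (1 gchoose n)"
    using gbinomial_Vandermonde[of "1/2 :: real" "1/2" n]
    by (simp add: atLeast0AtMost flip: sum_distrib_left)
  also have "1 gchoose n = real (1 choose n)" by (simp add: binomial_gbinomial)
  also have "(- 1) ^ n * real (1 choose n) = (if n = 0 then 1 else if n = 1 then - 1 else 0)"
    by (auto simp: binomial_eq_0)
  finally show ?thesis .
qed

text \<open>The binomial series of sqrt (1 - z) at C = 1 - A. Its coefficients are absolutely
  summable, so it converges for every contraction \<open>C\<close>, even when \<open>A\<close> has a
  kernel.\<close>

lemma pos_contr_sqrt:
  fixes A :: "'h::chilbert \<Rightarrow> 'h"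
  assumes M: "von_neumann_algebra M" and AM: "A \<in> M" and A: "pos_contr A"
  obtains B where "B \<in> M" "pos_contr B" "\<And>x. B (B x) = A x"
proof -
  define C where "C x = x - A x" for x
  have C: "pos_contr C" using pos_contr_compl[OF A] by (simp add: C_def[abs_def])
  have CM: "C \<in> M" using vna_diff[OF M vna_id[OF M] AM] by (simp add: C_def[abs_def])
  note nC = pos_contr_funpow_norm[OF C]
  define F where "F n x = (\<Sum>k<n. sqrt_coeff k *\<^sub>R (C ^^ k) x)" for n x
  define B where "B x = (\<Sum>k. sqrt_coeff k *\<^sub>R (C ^^ k) x)" for x
  have nsum: "summable (\<lambda>k. norm (sqrt_coeff k *\<^sub>R (C ^^ k) x))" for x
  proof (rule summable_comparison_test')
    show "summable (\<lambda>k. \<bar>sqrt_coeff k\<bar> * norm x)" by (intro summable_mult2 summable_abs_sqrt_coeff)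
    show "norm (norm (sqrt_coeff k *\<^sub>R (C ^^ k) x)) \<le> \<bar>sqrt_coeff k\<bar> * norm x" if "0 \<le> k" for k
      using nC[of k x] by (simp add: mult_left_mono)
  qed
  have Bsums: "(\<lambda>k. sqrt_coeff k *\<^sub>R (C ^^ k) x) sums B x" for x
    unfolding B_def by (rule summable_sums, rule summable_norm_cancel, rule nsum)
  have Bhas: "((\<lambda>k. sqrt_coeff k *\<^sub>R (C ^^ k) x) has_sum B x) UNIV" for x
    by (rule norm_summable_imp_has_sum[OF nsum Bsums])
  have lim: "(\<lambda>n. F n x) \<longlonglongrightarrow> B x" for x
    using Bsums unfolding sums_def F_def .
  have FM: "F n \<in> M" for n
  proof (induction n)
    case 0
    have "(\<lambda>x. scaleC 0 (id x)) \<in> M" by (intro vna_smult vna_id M)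
    then show ?case by (simp add: F_def[abs_def])
  next
    case (Suc n)
    have "(\<lambda>x. F n x + scaleC (complex_of_real (sqrt_coeff n)) ((C ^^ n) x)) \<in> M"
      by (intro vna_plus vna_smult vna_funpow M CM Suc)
    then show ?case by (simp add: F_def[abs_def] scaleR_scaleC)
  qed
  have bd: "norm (F n x) \<le> 2 * norm x" for n x
  proof -
    have "norm (F n x) \<le> (\<Sum>k<n. \<bar>sqrt_coeff k\<bar> * norm x)"
      unfolding F_def by (rule sum_norm_le) (simp add: nC mult_left_mono)
    also have "\<dots> \<le> 2 * norm x"
      unfolding sum_distrib_right[symmetric] by (intro mult_right_mono sqrt_coeff_abs_sum_le) auto
    finally show ?thesis .
  qed
  have BM: "B \<in> M" by (rule vna_pointwise_limit[OF M FM lim bd])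
  have Bb: "B \<in> bounded_ops" using M BM by (rule vna_bounded_ops)
  have sa: "inner (B x) y = inner x (B y)" for x y
  proof (rule LIMSEQ_unique)
    show "(\<lambda>n. inner (F n x) y) \<longlonglongrightarrow> inner (B x) y" by (intro tendsto_intros lim)
    have "inner (F n x) y = inner x (F n y)" for n
      by (simp add: F_def inner_sum_left inner_sum_right pos_contr_funpow_selfadj[OF C])
    then show "(\<lambda>n. inner (F n x) y) \<longlonglongrightarrow> inner x (B y)"
      by (simp add: tendsto_inner[OF tendsto_const lim])
  qed
  \<comment> \<open>The terms after the first are nonpositive, whence the upper bound; replacing the
    forms of the powers by \<open>inner x x\<close> leaves a partial sum of coefficients, whence the
    lower one. \<open>Suc n\<close> keeps the leading term in the sum.\<close>
  have Fbds: "0 \<le> inner (F (Suc n) x) x \<and> inner (F (Suc n) x) x \<le> inner x x" for n x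
  proof -
    have e: "inner (F (Suc n) x) x = inner x x + (\<Sum>k<n. sqrt_coeff (Suc k) * inner ((C ^^ Suc k) x) x)"
      unfolding F_def sum.lessThan_Suc_shift by (simp add: inner_add_left inner_sum_left)
    have "(\<Sum>k<n. sqrt_coeff (Suc k) * inner ((C ^^ Suc k) x) x) \<le> 0"
      by (intro sum_nonpos mult_nonpos_nonneg sqrt_coeff_Suc_nonpos pos_contr_funpow_nonneg[OF C])
    moreover have "(\<Sum>k<n. sqrt_coeff (Suc k) * inner x x)
        \<le> (\<Sum>k<n. sqrt_coeff (Suc k) * inner ((C ^^ Suc k) x) x)"
    proof (rule sum_mono)
      fix k
      have "inner ((C ^^ n) x) x \<le> inner x x" for n
      proof (induction n)
        case (Suc n)
        then show ?case using pos_contr_funpow_antimono[OF C, of n x] by linarith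
      qed simp
      then show "sqrt_coeff (Suc k) * inner x x \<le> sqrt_coeff (Suc k) * inner ((C ^^ Suc k) x) x"
        by (intro mult_left_mono_neg sqrt_coeff_Suc_nonpos)
    qed
    moreover have "0 \<le> inner x x + (\<Sum>k<n. sqrt_coeff (Suc k) * inner x x)"
    proof -
      have "inner x x + (\<Sum>k<n. sqrt_coeff (Suc k) * inner x x) = (\<Sum>k\<le>n. sqrt_coeff k) * inner x x"
        unfolding lessThan_Suc_atMost[symmetric] sum.lessThan_Suc_shift
        by (simp add: distrib_right sum_distrib_right)
      then show ?thesis using sqrt_coeff_partial_sum_nonneg by simp
    qed
    ultimately show ?thesis unfolding e by linarith
  qed
  have limS: "(\<lambda>n. inner (F (Suc n) x) x) \<longlonglongrightarrow> inner (B x) x" for x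
    by (intro tendsto_inner tendsto_const LIMSEQ_Suc lim)
  have pos: "pos_contr B"
    unfolding pos_contr_def
  proof (intro conjI allI Bb sa)
    show "0 \<le> inner (B x) x" for x
      using LIMSEQ_le_const[OF limS] Fbds by blast
    show "inner (B x) x \<le> inner x x" for x
      using LIMSEQ_le_const2[OF limS] Fbds by blast
  qed
  have "B (B x) = A x" for x
  proof -
    \<comment> \<open>The Cauchy product as a double series: summed by rows it is
      \<open>B (B x)\<close>, by antidiagonals it collapses to the convolution of the
      coefficients.\<close>
    define f where "f = (\<lambda>(i, j). (sqrt_coeff i * sqrt_coeff j) *\<^sub>R (C ^^ (i + j)) x)"
    have absum: "((\<lambda>n. \<bar>sqrt_coeff n\<bar>) has_sum (\<Sum>n. \<bar>sqrt_coeff n\<bar>)) UNIV"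
      using norm_summable_imp_has_sum[of "\<lambda>n. \<bar>sqrt_coeff n\<bar>"] summable_abs_sqrt_coeff
      by (simp add: summable_sums)
    then have "(\<lambda>p. \<bar>sqrt_coeff (fst p)\<bar> * \<bar>sqrt_coeff (snd p)\<bar> * norm x) summable_on UNIV \<times> UNIV"
      by (intro summable_on_cmult_left summable_on_SigmaI[where
            g = "\<lambda>i. \<bar>sqrt_coeff i\<bar> * (\<Sum>n. \<bar>sqrt_coeff n\<bar>)"])
        (auto intro: has_sum_cmult_right has_sum_imp_summable)
    then have "(\<lambda>p. norm (f p)) summable_on UNIV \<times> UNIV"
      by (rule Infinite_Sum.abs_summable_on_comparison_test') (auto simp: f_def abs_mult nC mult_left_mono)
    then have fsum: "f summable_on UNIV \<times> UNIV" by (rule Infinite_Sum.abs_summable_summable)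
    have "(f has_sum B (B x)) (UNIV \<times> UNIV)"
    proof (rule has_sum_SigmaI[OF _ Bhas fsum])
      fix i
      have "bounded_linear (\<lambda>z. sqrt_coeff i *\<^sub>R (C ^^ i) z)"
        by (intro bounded_linear_const_scaleR bounded_ops_bounded_linear pos_contr_funpow_bounded_ops C)
      from has_sum_bounded_linear[OF this Bhas]
      show "((\<lambda>j. f (i, j)) has_sum sqrt_coeff i *\<^sub>R (C ^^ i) (B x)) UNIV"
        by (simp add: f_def funpow_add bounded_ops_scaleR[OF pos_contr_funpow_bounded_ops[OF C]])
    qed
    then have "((\<lambda>(n, k). f (k, n - k)) has_sum B (B x)) (Sigma UNIV (\<lambda>n. {..n}))"
      by (subst has_sum_reindex_bij_witness[where i = "\<lambda>(k, l). (k + l, k)"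
            and j = "\<lambda>(n, k). (k, n - k)" and T = "UNIV \<times> UNIV" and h = f]) auto
    then have "((\<lambda>n. \<Sum>k\<le>n. f (k, n - k)) has_sum B (B x)) UNIV"
      by (rule has_sum_SigmaD) (auto intro: has_sum_finite)
    moreover have "(\<Sum>k\<le>n. f (k, n - k))
        = (if n = 0 then 1 else if n = 1 then - 1 else 0) *\<^sub>R (C ^^ n) x" for n
      unfolding sqrt_coeff_convolution[symmetric] by (simp add: f_def scaleR_sum_left)
    ultimately have "((\<lambda>n. (if n = 0 then 1 else if n = 1 then - 1 else 0) *\<^sub>R (C ^^ n) x)
        has_sum B (B x)) UNIV" by simp
    from has_sum_imp_sums[OF this]
    have "(\<lambda>n. (if n = 0 then 1 else if n = 1 then - 1 else 0) *\<^sub>R (C ^^ n) x) sums B (B x)" .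
    moreover have "(\<lambda>n. (if n = 0 then 1 else if n = 1 then - 1 else 0) *\<^sub>R (C ^^ n) x) sums
        (\<Sum>n\<in>{0, 1}. (if n = 0 then 1 else if n = 1 then - 1 else 0) *\<^sub>R (C ^^ n) x)"
      by (rule sums_finite) auto
    ultimately have "B (B x) = x - C x" by (auto dest: sums_unique2)
    then show ?thesis by (simp add: C_def)
  qed
  then show thesis using that BM pos by blast
qed

section \<open>Factorisation through an operator with the same range\<close>

text \<open>The argument behind Douglas' range inclusion: the vectors \<open>E y\<close> with
  \<open>norm (cadj C y) \<le> 1\<close> are weakly bounded, because pairing with \<open>x\<close>
  becomes pairing \<open>cadj C y\<close> with a \<open>C\<close>-preimage of \<open>E x\<close>;
  uniform boundedness does the rest.\<close>

lemma adjoint_bounded_below: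
  fixes C E :: "'h::chilbert \<Rightarrow> 'h"
  assumes C: "C \<in> bounded_ops" and E: "E \<in> bounded_ops"
    and sa: "\<And>x y. inner (E x) y = inner x (E y)"
    and ran: "\<And>x. \<exists>z. C z = E x"
  obtains K where "0 < K" "\<And>y. norm (E y) \<le> K * norm (cadj C y)"
proof -
  define Y where "Y = E ` {y. norm (cadj C y) \<le> 1}"
  have "\<exists>K. \<forall>y\<in>Y. \<bar>inner x y\<bar> \<le> K" for x
  proof -
    obtain z where z: "C z = E x" using ran by blast
    have "\<bar>inner x (E y)\<bar> \<le> norm z" if "norm (cadj C y) \<le> 1" for y
    proof -
      have "inner x (E y) = inner z (cadj C y)" by (simp add: cadj_inner[OF C, symmetric] z sa)
      also have "\<bar>\<dots>\<bar> \<le> norm z * norm (cadj C y)" by (rule Cauchy_Schwarz_ineq2)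
      also have "\<dots> \<le> norm z * 1" using that by (intro mult_left_mono) auto
      finally show ?thesis by simp
    qed
    then show ?thesis by (auto simp: Y_def)
  qed
  then have "bounded Y" by (rule uniform_boundedness_inner)
  then obtain K where K: "0 < K" "\<And>y. norm (cadj C y) \<le> 1 \<Longrightarrow> norm (E y) \<le> K"
    by (auto simp: Y_def bounded_pos)
  have "norm (E y) \<le> K * norm (cadj C y)" for y
  proof -
    have scaled: "r * norm (E y) \<le> K" if "0 \<le> r" "r * norm (cadj C y) \<le> 1" for r
      using K(2)[of "r *\<^sub>R y"] that
      by (simp add: bounded_ops_scaleR[OF E] bounded_ops_scaleR[OF cadj_bounded_ops[OF C]])
    show ?thesis
    proof (cases "cadj C y = 0")
      case True
      have "E y = 0"
      proof (rule ccontr)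
        assume "E y \<noteq> 0"
        \<comment> \<open>Multiples of \<open>y\<close> of any size are admissible here; this factor
          would give length \<open>2 * K\<close>, more than \<open>K\<close>.\<close>
        then show False using scaled[of "2 * K / norm (E y)"] True K(1) by simp
      qed
      then show ?thesis using K(1) by simp
    next
      case False
      then show ?thesis using scaled[of "1 / norm (cadj C y)"] by (simp add: field_simps)
    qed
  qed
  then show thesis using that K(1) by blast
qed

text \<open>Normal equations: S = C C* + 1 - E is coercive and satisfies E S = C C*, so D = C* S^-1
  solves C D = E. This choice of preimages is given by an operator of \<open>M\<close>, as the
  inverse of \<open>S\<close> commutes with whatever \<open>S\<close> commutes with.\<close>

lemma vna_right_factor:
  fixes C E :: "'h::chilbert \<Rightarrow> 'h"
  assumes M: "von_neumann_algebra M" and CM: "C \<in> M" and EM: "E \<in> M"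
    and sa: "\<And>x y. inner (E x) y = inner x (E y)"
    and EC: "\<And>x. E (C x) = C x" and ran: "\<And>x. \<exists>z. C z = E x"
  obtains D where "D \<in> M" "\<And>x. C (D x) = E x"
proof -
  have C: "C \<in> bounded_ops" and E: "E \<in> bounded_ops" using vna_bounded_ops[OF M] CM EM by blast+
  have EE: "E (E x) = E x" for x using ran[of x] EC by metis
  obtain K where K: "0 < K" "\<And>y. norm (E y) \<le> K * norm (cadj C y)"
    using adjoint_bounded_below[OF C E sa ran] by blast
  define S where "S x = C (cadj C x) + (x - E x)" for x
  have SM: "S \<in> M"
    using vna_plus[OF M vna_comp[OF M CM vna_cadj[OF M CM]] vna_diff[OF M vna_id[OF M] EM]]
    by (simp add: S_def[abs_def])
  have S: "S \<in> bounded_ops" using M SM by (rule vna_bounded_ops)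
  \<comment> \<open>The form of \<open>S\<close> is at least \<open>1 / K^2\<close> on the range of
    \<open>E\<close> and equals 1 on the complement.\<close>
  define a where "a = min (1 / K\<^sup>2) 1"
  have a: "0 < a" "a \<le> 1" "a * K\<^sup>2 \<le> 1" using K(1) by (auto simp: a_def min_def field_simps)
  have "a * inner x x \<le> inner (S x) x" for x
  proof -
    have split: "inner (x - E x) x = inner (x - E x) (x - E x)"
      "inner (E x) x = inner (E x) (E x)"
      by (simp_all add: inner_diff_left inner_diff_right sa EE)
    have "a * inner (E x) (E x) \<le> a * (K\<^sup>2 * inner (cadj C x) (cadj C x))"
      using power_mono[OF K(2)[of x], of 2] a(1)
      by (intro mult_left_mono) (simp_all add: power_mult_distrib power2_norm_eq_inner)
    also have "\<dots> \<le> 1 * inner (cadj C x) (cadj C x)"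
      unfolding mult.assoc[symmetric] using a(3) by (intro mult_right_mono) auto
    finally have 1: "a * inner (E x) (E x) \<le> inner (cadj C x) (cadj C x)" by simp
    have 2: "a * inner (x - E x) (x - E x) \<le> 1 * inner (x - E x) (x - E x)"
      using a(2) by (intro mult_right_mono) auto
    have "inner x x = inner (E x) x + inner (x - E x) x" by (simp add: inner_diff_left)
    then have "a * inner x x = a * inner (E x) (E x) + a * inner (x - E x) (x - E x)"
      unfolding split by (simp add: distrib_left)
    also have "\<dots> \<le> inner (cadj C x) (cadj C x) + inner (x - E x) x"
      using 1 2 split(1) by linarith
    also have "\<dots> = inner (S x) x"
      by (simp add: S_def inner_add_left cadj_inner[OF C])
    finally show ?thesis .
  qed
  note bij = bij_bounded_ops_inv[OF S a(1) this]
  have SI: "S (inv S x) = x" for x using bij by (simp add: bij_is_surj surj_f_inv_f)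
  have IS: "inv S (S x) = x" for x using bij by (simp add: bij_is_inj)
  have "inv S \<in> M"
  proof (rule vnaI[OF M bij(2)])
    fix X x assume X: "X \<in> commutant M"
    have "S (X (inv S x)) = X x" using commutantD[OF X SM] SI by metis
    then show "inv S (X x) = X (inv S x)" by (metis IS)
  qed
  then have "cadj C \<circ> inv S \<in> M" by (intro vna_comp vna_cadj M CM)
  moreover have "C ((cadj C \<circ> inv S) x) = E x" for x
  proof -
    have "E (S y) = C (cadj C y)" for y
      by (simp add: S_def bounded_ops_add[OF E] bounded_ops_diff[OF E] EC EE)
    then show ?thesis using SI[of x] by (metis comp_apply)
  qed
  ultimately show thesis by (rule that)
qed

section \<open>Graphs of quotients\<close>

lemma map_graph_eq_iff: "Map.graph S = Map.graph T \<longleftrightarrow> S = T"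
proof
  assume eq: "Map.graph S = Map.graph T"
  have "S x = Some y \<longleftrightarrow> T x = Some y" for x y
    using arg_cong[OF eq, of "\<lambda>G. (x, y) \<in> G"] by (simp add: graph_def)
  then have "S x = T x" for x by (metis not_Some_eq)
  then show "S = T" by (rule ext)
qed simp

lemma quot_apply:
  assumes A: "A \<in> bounded_ops" and B: "B \<in> bounded_ops" and le: "null B \<subseteq> null A"
  shows "quot A B (B x) = Some (A x)"
proof -
  have eq: "A x' = A x" if "B x = B x'" for x'
  proof -
    have "x - x' \<in> null B" using that by (simp add: null_def bounded_ops_diff[OF B])
    then show ?thesis using le by (auto simp: null_def bounded_ops_diff[OF A])
  qed
  have "(THE z. \<exists>x'. B x = B x' \<and> z = A x') = A x" by (rule the_equality) (use eq in blast)+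
  then show ?thesis by (simp add: quot_def)
qed

lemma graph_quot:
  assumes "A \<in> bounded_ops" "B \<in> bounded_ops" "null B \<subseteq> null A"
  shows "Map.graph (quot A B) = range (\<lambda>x. (B x, A x))"
proof -
  have "quot A B y = None" if "y \<notin> range B" for y using that by (simp add: quot_def)
  then have "(y, z) \<in> Map.graph (quot A B) \<longleftrightarrow> (\<exists>x. y = B x \<and> z = A x)" for y z
    using quot_apply[OF assms] by (cases "y \<in> range B") (auto simp: graph_def)
  then show ?thesis by auto
qed

text \<open>Mutual factorisation of the columns turns equality of quotients into operator
  identities, which a homomorphism preserves.\<close>

lemma quot_eqI:
  assumes A: "A \<in> bounded_ops" "B \<in> bounded_ops" and le: "null B \<subseteq> null A"
    and C: "\<And>x. A' x = A (C x)" "\<And>x. B' x = B (C x)"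
    and D: "\<And>x. A x = A' (D x)" "\<And>x. B x = B' (D x)"
    and A': "A' \<in> bounded_ops" "B' \<in> bounded_ops"
  shows "null B' \<subseteq> null A'" and "quot A' B' = quot A B"
proof -
  show le': "null B' \<subseteq> null A'" using le by (auto simp: null_def C)
  have "range (\<lambda>x. (B' x, A' x)) = range (\<lambda>x. (B x, A x))"
  proof (intro antisym subsetI)
    fix p assume "p \<in> range (\<lambda>x. (B' x, A' x))"
    then show "p \<in> range (\<lambda>x. (B x, A x))" by (auto simp: C)
  next
    fix p assume "p \<in> range (\<lambda>x. (B x, A x))"
    then show "p \<in> range (\<lambda>x. (B' x, A' x))" by (auto simp: D)
  qed
  then show "quot A' B' = quot A B"
    by (simp add: graph_quot[OF A le] graph_quot[OF A' le'] flip: map_graph_eq_iff)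
qed

lemma unbounded_op_quot:
  assumes A: "A \<in> bounded_ops" and B: "B \<in> bounded_ops" and le: "null B \<subseteq> null A"
  shows "unbounded_op (quot A B)"
proof -
  have dom: "x \<in> dom (quot A B) \<longleftrightarrow> (\<exists>z. x = B z)" for x
    using quot_apply[OF assms] by (auto simp: dom_def quot_def)
  have val: "the (quot A B (B z)) = A z" for z by (simp add: quot_apply[OF assms])
  have add: "B z + B w \<in> dom (quot A B) \<and> the (quot A B (B z + B w)) = A z + A w" for z w
    using val[of "z + w"] dom[of "B z + B w"] by (auto simp: bounded_ops_add[OF A] simp flip: bounded_ops_add[OF B])
  have sc: "scaleC c (B z) \<in> dom (quot A B) \<and> the (quot A B (scaleC c (B z))) = scaleC c (A z)" for c z
    using val[of "scaleC c z"] dom[of "scaleC c (B z)"]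
    by (auto simp: bounded_ops_scaleC[OF A] simp flip: bounded_ops_scaleC[OF B])
  have "0 \<in> dom (quot A B)" using dom[of 0] bounded_ops_zero[OF B] by metis
  moreover have "x + y \<in> dom (quot A B) \<and> the (quot A B (x + y)) = the (quot A B x) + the (quot A B y)"
    if xy: "x \<in> dom (quot A B)" "y \<in> dom (quot A B)" for x y
  proof -
    obtain z w where "x = B z" "y = B w" using xy dom by blast
    then show ?thesis using add[of z w] by (simp add: val)
  qed
  moreover have "scaleC c x \<in> dom (quot A B) \<and> the (quot A B (scaleC c x)) = scaleC c (the (quot A B x))"
    if x: "x \<in> dom (quot A B)" for x c
  proof -
    obtain z where "x = B z" using x dom by blast
    then show ?thesis using sc[of c z] by (simp add: val)
  qed
  ultimately show ?thesis unfolding unbounded_op_def by blast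
qed

section \<open>Orthogonal projections and characteristic projections\<close>

lemma orth_proj_eqI:
  fixes V :: "'h::chilbert set"
  assumes sub: "subspace V" and sc: "\<And>c w. w \<in> V \<Longrightarrow> scaleC c w \<in> V"
    and v: "v \<in> V" "\<And>w. w \<in> V \<Longrightarrow> inner (x - v) w = 0"
  shows "orth_proj V x = v"
proof -
  have "orth_proj V x = (THE v. v \<in> V \<and> (\<forall>w\<in>V. inner (x - v) w = 0))"
    unfolding orth_proj_def by (simp only: cinner_eq_zero_of_csubspace[of V, OF sc])
  also have "\<dots> = v"
  proof (rule the_equality)
    show "v \<in> V \<and> (\<forall>w\<in>V. inner (x - v) w = 0)" using v by blast
    fix u assume u: "u \<in> V \<and> (\<forall>w\<in>V. inner (x - u) w = 0)"
    then have "v - u \<in> V" using sub v by (auto intro: subspace_diff)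
    then have "inner (x - u) (v - u) - inner (x - v) (v - u) = 0" using u v by simp
    then have "inner (v - u) (v - u) = 0" by (simp flip: inner_diff_left)
    then show "u = v" by simp
  qed
  finally show ?thesis .
qed

lemma
  fixes V :: "'h::chilbert set"
  assumes sub: "subspace V" and sc: "\<And>c w. w \<in> V \<Longrightarrow> scaleC c w \<in> V" and cl: "closed V"
  shows orth_proj_in: "orth_proj V x \<in> V"
    and orth_proj_orthogonal: "w \<in> V \<Longrightarrow> inner (x - orth_proj V x) w = 0"
proof -
  obtain v where v: "v \<in> V" "\<forall>w\<in>V. inner (x - v) w = 0"
    using orthogonal_projection_exists[OF sub cl] by blast
  have "orth_proj V x = v" by (rule orth_proj_eqI[OF sub sc]) (use v in auto)
  then show "orth_proj V x \<in> V" "w \<in> V \<Longrightarrow> inner (x - orth_proj V x) w = 0" using v by auto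
qed

lemma subspace_graph:
  assumes "unbounded_op T"
  shows "subspace (Map.graph T)" and "\<And>c w. w \<in> Map.graph T \<Longrightarrow> scaleC c w \<in> Map.graph T"
proof -
  have T0: "0 \<in> dom T"
    and add: "\<And>x y. x \<in> dom T \<Longrightarrow> y \<in> dom T \<Longrightarrow> x + y \<in> dom T \<and> the (T (x + y)) = the (T x) + the (T y)"
    and sc: "\<And>c x. x \<in> dom T \<Longrightarrow> scaleC c x \<in> dom T \<and> the (T (scaleC c x)) = scaleC c (the (T x))"
    using assms by (auto simp: unbounded_op_def)
  have mem: "(x, y) \<in> Map.graph T \<longleftrightarrow> x \<in> dom T \<and> the (T x) = y" for x y
    by (auto simp: graph_def)
  have scaleC: "scaleC c w \<in> Map.graph T" if "w \<in> Map.graph T" for c w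
    using that sc by (cases w) (auto simp: mem scaleC_prod_def)
  show "scaleC c w \<in> Map.graph T" if "w \<in> Map.graph T" for c w using scaleC that .
  have "the (T 0) = 0" using add[OF T0 T0] by simp
  then have "0 \<in> Map.graph T" using T0 by (simp add: mem zero_prod_def)
  moreover have "v + w \<in> Map.graph T" if "v \<in> Map.graph T" "w \<in> Map.graph T" for v w
    using that add by (cases v, cases w) (auto simp: mem)
  ultimately show "subspace (Map.graph T)"
    using scaleC by (simp add: subspace_def scaleR_scaleC)
qed

lemma charproj_closed_op:
  assumes "closed_op T"
  shows "charproj T = orth_proj (Map.graph T)"
    and "Map.graph T = range (charproj T)"
proof -
  have T: "unbounded_op T" "closed (Map.graph T)" using assms by (auto simp: closed_op_def)
  show eq: "charproj T = orth_proj (Map.graph T)" using T(2) by (simp add: charproj_def closure_closed)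
  have "orth_proj (Map.graph T) w = w" if "w \<in> Map.graph T" for w
    by (rule orth_proj_eqI[OF subspace_graph[OF T(1)]]) (use that in auto)
  then have "Map.graph T \<subseteq> range (charproj T)" unfolding eq by (metis rangeI subsetI)
  moreover have "range (charproj T) \<subseteq> Map.graph T"
    unfolding eq using orth_proj_in[OF subspace_graph[OF T(1)] T(2)] by blast
  ultimately show "Map.graph T = range (charproj T)" by (rule antisym)
qed

lemma inj_on_charproj: "inj_on charproj (Collect closed_op)"
proof (rule inj_onI)
  fix S T :: "'h::chilbert \<rightharpoonup> 'h"
  assume "S \<in> Collect closed_op" "T \<in> Collect closed_op" "charproj S = charproj T"
  then have "Map.graph S = Map.graph T" by (simp add: charproj_closed_op(2))
  then show "S = T" by (simp add: map_graph_eq_iff)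
qed

subsection \<open>Column partial isometries\<close>

text \<open>The column with entries \<open>B\<close> and \<open>A\<close> is a partial isometry with initial projection \<open>E\<close>, and
  \<open>E\<close> is the support of its first entry, so that its range is the graph of \<open>A / B\<close>.\<close>

definition col_isometry :: "('h::chilbert \<Rightarrow> 'h) \<Rightarrow> ('h \<Rightarrow> 'h) \<Rightarrow> ('h \<Rightarrow> 'h) \<Rightarrow> bool" where
  "col_isometry A B E \<longleftrightarrow> A \<in> bounded_ops \<and> B \<in> bounded_ops \<and> E \<in> bounded_ops \<and>
     (\<forall>x y. inner (E x) y = inner x (E y)) \<and> (\<forall>x. E (E x) = E x) \<and>
     (\<forall>x. cadj B (B x) + cadj A (A x) = E x) \<and> null B \<subseteq> null E"

context
  fixes A B E :: "'h::chilbert \<Rightarrow> 'h"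
  assumes ci: "col_isometry A B E"
begin

lemma
  shows col_isometry_bounded_ops: "A \<in> bounded_ops" "B \<in> bounded_ops" "E \<in> bounded_ops"
    and col_isometry_selfadj: "inner (E x) y = inner x (E y)"
    and col_isometry_idem: "E (E x) = E x"
    and col_isometry_eq: "cadj B (B x) + cadj A (A x) = E x"
  using ci by (auto simp: col_isometry_def)

lemma col_isometry_inner: "inner (B x) (B y) + inner (A x) (A y) = inner (E x) y"
proof -
  have "inner (cadj B (B x) + cadj A (A x)) y = inner (B x) (B y) + inner (A x) (A y)"
    using col_isometry_bounded_ops by (simp add: inner_add_left cadj_inner_right)
  then show ?thesis by (simp add: col_isometry_eq)
qed

lemma col_isometry_zero:
  assumes "E x = 0"
  shows "B x = 0" "A x = 0"
proof -
  have "inner (B x) (B x) + inner (A x) (A x) = 0" using col_isometry_inner[of x x] assms by simp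
  then have "inner (B x) (B x) = 0 \<and> inner (A x) (A x) = 0"
    by (simp add: add_nonneg_eq_0_iff)
  then show "B x = 0" "A x = 0" by auto
qed

lemma col_isometry_null: "null B \<subseteq> null A"
  using ci col_isometry_zero by (auto simp: col_isometry_def null_def)

lemma col_isometry_comp: "B (E x) = B x" "A (E x) = A x"
proof -
  have "E (E x - x) = 0" using col_isometry_idem by (simp add: bounded_ops_diff[OF col_isometry_bounded_ops(3)])
  from col_isometry_zero[OF this] show "B (E x) = B x" "A (E x) = A x"
    by (simp_all add: bounded_ops_diff[OF col_isometry_bounded_ops(1)]
        bounded_ops_diff[OF col_isometry_bounded_ops(2)])
qed

text \<open>These are the adjoints of the relations B E = B and A E = A.\<close>

lemma col_isometry_cadj: "E (cadj B y) = cadj B y" "E (cadj A y) = cadj A y"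
proof -
  have "inner (E (cadj B y)) z = inner (cadj B y) z" for z
    by (simp add: col_isometry_selfadj col_isometry_comp col_isometry_bounded_ops flip: cadj_inner_right)
  then show "E (cadj B y) = cadj B y" by (rule real_inner_eqI)
  have "inner (E (cadj A y)) z = inner (cadj A y) z" for z
    by (simp add: col_isometry_selfadj col_isometry_comp col_isometry_bounded_ops flip: cadj_inner_right)
  then show "E (cadj A y) = cadj A y" by (rule real_inner_eqI)
qed

lemma graph_col_isometry: "Map.graph (quot A B) = range (\<lambda>x. (B x, A x))"
  by (intro graph_quot col_isometry_bounded_ops col_isometry_null)

text \<open>With W the column, convergence of W x_n makes W* W x_n = E x_n converge, to e say; since
  W E = W, the limit is W e.\<close>

lemma col_isometry_closed: "closed (range (\<lambda>x. (B x, A x)))"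
proof (unfold closed_sequential_limits, intro allI impI, elim conjE)
  fix u p assume u: "\<forall>n. u n \<in> range (\<lambda>x. (B x, A x))" and lim: "u \<longlonglongrightarrow> p"
  then have "\<forall>n. \<exists>x. u n = (B x, A x)" by blast
  then obtain x where x: "\<And>n. u n = (B (x n), A (x n))" by metis
  obtain b a where p: "p = (b, a)" by fastforce
  note bo = col_isometry_bounded_ops
  have B: "(\<lambda>n. B (x n)) \<longlonglongrightarrow> b" and A: "(\<lambda>n. A (x n)) \<longlonglongrightarrow> a"
    using tendsto_fst[OF lim] tendsto_snd[OF lim] by (simp_all add: x p)
  define e where "e = cadj B b + cadj A a"
  have "(\<lambda>n. cadj B (B (x n)) + cadj A (A (x n))) \<longlonglongrightarrow> e"
    unfolding e_def
    by (intro tendsto_add bounded_ops_tendsto[OF cadj_bounded_ops[OF bo(2)] B]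
        bounded_ops_tendsto[OF cadj_bounded_ops[OF bo(1)] A])
  then have E: "(\<lambda>n. E (x n)) \<longlonglongrightarrow> e" by (simp add: col_isometry_eq)
  have "(\<lambda>n. B (E (x n))) \<longlonglongrightarrow> B e" "(\<lambda>n. A (E (x n))) \<longlonglongrightarrow> A e"
    by (rule bounded_ops_tendsto[OF bo(2) E], rule bounded_ops_tendsto[OF bo(1) E])
  then have "b = B e" "a = A e" using A B by (auto simp: col_isometry_comp intro: LIMSEQ_unique)
  then show "p \<in> range (\<lambda>x. (B x, A x))" by (simp add: p)
qed

lemma closed_op_col_isometry: "closed_op (quot A B)"
  using col_isometry_closed
  by (simp add: closed_op_def graph_col_isometry unbounded_op_quot col_isometry_bounded_ops
      col_isometry_null)

lemma charproj_col_isometry: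
  "charproj (quot A B) = opmat (B \<circ> cadj B) (B \<circ> cadj A) (A \<circ> cadj B) (A \<circ> cadj A)"
proof (rule ext)
  fix p :: "'h \<times> 'h"
  obtain x y where p: "p = (x, y)" by fastforce
  note bo = col_isometry_bounded_ops
  note sub = subspace_graph[OF unbounded_op_quot[OF bo(1,2) col_isometry_null]]
  \<comment> \<open>This is W* applied to \<open>p\<close>; the claim is that W W* projects onto the
    range of W.\<close>
  define e where "e = cadj B x + cadj A y"
  have Ee: "E e = e" by (simp add: e_def bounded_ops_add[OF bo(3)] col_isometry_cadj)
  have "orth_proj (Map.graph (quot A B)) p = (B e, A e)"
  proof (rule orth_proj_eqI[OF sub])
    show "(B e, A e) \<in> Map.graph (quot A B)" by (simp add: graph_col_isometry)
    fix w assume "w \<in> Map.graph (quot A B)"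
    then obtain z where w: "w = (B z, A z)" by (auto simp: graph_col_isometry)
    have "inner (p - (B e, A e)) w = inner x (B z) + inner y (A z) - (inner (B e) (B z) + inner (A e) (A z))"
      by (simp add: p w inner_diff_left)
    also have "inner x (B z) + inner y (A z) = inner e z"
      by (simp add: e_def inner_add_left cadj_inner_right bo)
    also have "inner (B e) (B z) + inner (A e) (A z) = inner (E e) z" by (rule col_isometry_inner)
    finally show "inner (p - (B e, A e)) w = 0" by (simp add: Ee)
  qed
  then show "charproj (quot A B) p = opmat (B \<circ> cadj B) (B \<circ> cadj A) (A \<circ> cadj B) (A \<circ> cadj A) p"
    by (simp add: charproj_closed_op(1)[OF closed_op_col_isometry] p opmat_def e_def
        bounded_ops_add[OF bo(1)] bounded_ops_add[OF bo(2)])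
qed

end

section \<open>Closed affiliated operators as quotients\<close>

lemma
  fixes T :: "'h::chilbert \<rightharpoonup> 'h"
  assumes T: "closed_op T"
  shows charproj_in_graph: "charproj T p \<in> Map.graph T"
    and charproj_orthogonal: "w \<in> Map.graph T \<Longrightarrow> inner (p - charproj T p) w = 0"
    and charproj_graph: "w \<in> Map.graph T \<Longrightarrow> charproj T w = w"
    and charproj_selfadj: "inner (charproj T p) q = inner p (charproj T q)"
    and charproj_bounded_ops: "charproj T \<in> bounded_ops"
proof -
  have T': "unbounded_op T" "closed (Map.graph T)" using T by (auto simp: closed_op_def)
  note sub = subspace_graph[OF T'(1)]
  let ?P = "charproj T"
  note eq = charproj_closed_op(1)[OF T]
  show in_graph: "?P p \<in> Map.graph T" for p
    unfolding eq using orth_proj_in[OF sub T'(2)] .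
  show orth: "inner (p - ?P p) w = 0" if "w \<in> Map.graph T" for p w
    unfolding eq using orth_proj_orthogonal[OF sub T'(2) that] .
  have eqI: "?P p = v" if "v \<in> Map.graph T" "\<And>w. w \<in> Map.graph T \<Longrightarrow> inner (p - v) w = 0" for p v
    unfolding eq by (rule orth_proj_eqI[OF sub that])
  show "?P w = w" if "w \<in> Map.graph T" for w by (rule eqI) (use that in auto)
  have PP: "inner (?P p) q = inner (?P p) (?P q)" for p q
    using orth[OF in_graph, of q p] by (simp add: inner_diff_left inner_diff_right inner_commute)
  show "inner (?P p) q = inner p (?P q)" for p q
    using PP[of p q] PP[of q p] by (simp add: inner_commute)
  have P_le: "norm (?P p) \<le> 1 * norm p" for p
  proof -
    have "norm (?P p) * norm (?P p) = inner (?P p) p"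
      using PP[of p p] by (simp add: dot_square_norm power2_eq_square)
    also have "\<dots> \<le> norm (?P p) * norm p" by (rule norm_cauchy_schwarz)
    finally show ?thesis by (cases "?P p = 0") auto
  qed
  show "?P \<in> bounded_ops"
  proof (rule bounded_opsI[OF _ _ P_le])
    fix p q c
    show "?P (p + q) = ?P p + ?P q"
    proof (rule eqI)
      show "?P p + ?P q \<in> Map.graph T" by (intro subspace_add sub in_graph)
      show "inner (p + q - (?P p + ?P q)) w = 0" if "w \<in> Map.graph T" for w
        using orth[OF that, of p] orth[OF that, of q] by (simp add: inner_diff_left inner_add_left)
    qed
    show "?P (scaleC c p) = scaleC c (?P p)"
    proof (rule eqI)
      show "scaleC c (?P p) \<in> Map.graph T" by (intro sub in_graph)
      show "inner (scaleC c p - scaleC c (?P p)) w = 0" if "w \<in> Map.graph T" for w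
        using orth[OF sub(2)[OF that, of "cnj c"], of p]
        by (simp add: inner_scaleC_left flip: scaleC_diff_right)
    qed
  qed
qed

lemma unitary_op_simps:
  assumes "unitary_op U"
  shows "U \<in> bounded_ops" "cadj U (U x) = x" "U (cadj U x) = x" "inner (U x) (U y) = inner x y"
proof -
  show U: "U \<in> bounded_ops" and UU: "cadj U (U x) = x" and "U (cadj U x) = x" for x
    using assms by (auto simp: unitary_op_def fun_eq_iff)
  show "inner (U x) (U y) = inner x y" by (simp add: cadj_inner[OF U] UU)
qed

text \<open>The unitary, acting in both coordinates, maps the graph onto itself and therefore
  commutes with the projection onto it.\<close>

lemma charproj_commutes_unitary:
  assumes T: "T \<in> aff_MvN M" and U: "U \<in> commutant M" "unitary_op U"
  shows "charproj T (U x, U y) = map_prod U U (charproj T (x, y))"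
proof -
  have cl: "closed_op T" using T by (simp add: aff_MvN_def)
  then have T': "unbounded_op T" by (simp add: closed_op_def)
  note u = unitary_op_simps[OF U(2)]
  have "(\<lambda>x. map_option (cadj U) (T (U x))) = T" using T U by (auto simp: aff_MvN_def)
  from fun_cong[OF this] have *: "map_option (cadj U) (T (U x)) = T x" for x .
  have "T x = Some y \<longleftrightarrow> T (U x) = Some (U y)" for x y
    unfolding *[of x, symmetric] map_option_eq_Some using u(2,3) by metis
  then have inv: "(x, y) \<in> Map.graph T \<longleftrightarrow> (U x, U y) \<in> Map.graph T" for x y by (simp add: graph_def)
  obtain a b where ab: "charproj T (x, y) = (a, b)" by fastforce
  have "orth_proj (Map.graph T) (U x, U y) = (U a, U b)"
  proof (rule orth_proj_eqI[OF subspace_graph[OF T']])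
    show "(U a, U b) \<in> Map.graph T" using charproj_in_graph[OF cl, of "(x, y)"] ab inv by simp
    fix w assume w: "w \<in> Map.graph T"
    obtain c d where cd: "w = (U c, U d)" by (metis prod.exhaust u(3))
    then have "(c, d) \<in> Map.graph T" using w inv by simp
    then have "inner ((x, y) - (a, b)) (c, d) = 0" using charproj_orthogonal[OF cl] ab by metis
    then show "inner ((U x, U y) - (U a, U b)) w = 0"
      by (simp add: cd u(4) flip: bounded_ops_diff[OF u(1)])
  qed
  then show ?thesis by (simp add: ab flip: charproj_closed_op(1)[OF cl])
qed

lemma charproj_column_vna:
  fixes T :: "'h::chilbert \<rightharpoonup> 'h"
  assumes M: "von_neumann_algebra M" and T: "T \<in> aff_MvN M"
  shows "(\<lambda>x. fst (charproj T (x, 0))) \<in> M" and "(\<lambda>x. snd (charproj T (x, 0))) \<in> M"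
proof -
  have cl: "closed_op T" using T by (simp add: aff_MvN_def)
  let ?P = "charproj T"
  note P = charproj_bounded_ops[OF cl]
  obtain K where K: "0 \<le> K" "\<And>p. norm (?P p) \<le> norm p * K"
    using bounded_linear.nonneg_bounded[OF bounded_ops_bounded_linear[OF P]] by blast
  have add: "?P (x + y, 0) = ?P (x, 0) + ?P (y, 0)" for x y :: 'h
    by (simp flip: bounded_ops_add[OF P])
  have sc: "?P (scaleC c x, 0) = scaleC c (?P (x, 0))" for c and x :: 'h
    using bounded_ops_scaleC[OF P, of c "(x, 0)"] by (simp add: scaleC_prod_def)
  have nm: "norm (?P (x, 0)) \<le> K * norm x" for x :: 'h
    using K(2)[of "(x, 0)"] by (simp add: norm_Pair mult.commute)
  have nm': "norm (fst (?P (x, 0))) \<le> K * norm x" "norm (snd (?P (x, 0))) \<le> K * norm x" for x :: 'h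
    using norm_fst_le[of "fst (?P (x, 0))" "snd (?P (x, 0))"]
      norm_snd_le[of "snd (?P (x, 0))" "fst (?P (x, 0))"] nm[of x] by (auto intro: order_trans)
  have comm: "?P (U x, 0) = map_prod U U (?P (x, 0))" if "U \<in> commutant M" "unitary_op U" for U and x :: 'h
    using charproj_commutes_unitary[OF T that, of x 0]
    by (simp add: bounded_ops_zero[OF commutant_bounded_ops[OF that(1)]])
  show "(\<lambda>x. fst (?P (x, 0))) \<in> M"
  proof (rule vnaI_unitary[OF M])
    show "(\<lambda>x. fst (?P (x, 0))) \<in> bounded_ops"
      by (rule bounded_opsI[where K = K])
        (simp_all add: add sc scaleC_prod_def nm')
  qed (simp add: comm)
  show "(\<lambda>x. snd (?P (x, 0))) \<in> M"
  proof (rule vnaI_unitary[OF M])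
    show "(\<lambda>x. snd (?P (x, 0))) \<in> bounded_ops"
      by (rule bounded_opsI[where K = K])
        (simp_all add: add sc scaleC_prod_def nm')
  qed (simp add: comm)
qed

text \<open>\<open>A = X B\<^sup>-\<^sup>1\<close> on the range of \<open>B\<close> and \<open>0\<close> on its complement.\<close>

lemma vna_left_quotient:
  fixes B X :: "'h::chilbert \<Rightarrow> 'h"
  defines "f \<equiv> \<lambda>n x. \<Sum>k<n. ((\<lambda>y. y - B y) ^^ k) x"
  assumes M: "von_neumann_algebra M" and BM: "B \<in> M" and B: "pos_contr B" and XM: "X \<in> M"
    and dom: "\<And>y. norm (X y) \<le> norm (B y)"
  obtains A where "A \<in> M" "\<And>x. (\<lambda>n. X (f n x)) \<longlonglongrightarrow> A x" "\<And>x. A (B x) = X x"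
proof -
  have X: "X \<in> bounded_ops" using M XM by (rule vna_bounded_ops)
  have Bb: "B \<in> bounded_ops" using M BM by (rule vna_bounded_ops)
  have Bf: "B (f n x) = x - ((\<lambda>y. y - B y) ^^ n) x" for n x
    unfolding f_def using diff_funpow_eq(1)[OF B, of x n] by simp
  have lim: "(\<lambda>n. B (f n x)) \<longlonglongrightarrow> supp B x" for x
    unfolding Bf by (rule supp_lim[OF B])
  \<comment> \<open>The sums \<open>f n x\<close> may diverge, but their images under
    \<open>B\<close> converge, and \<open>dom\<close> transfers the Cauchy property to the images
    under \<open>X\<close>.\<close>
  have "Cauchy (\<lambda>n. X (f n x))" for x
  proof (rule CauchyI)
    fix e :: real assume "0 < e"
    then obtain N where N: "\<And>m n. m \<ge> N \<Longrightarrow> n \<ge> N \<Longrightarrow> norm (B (f m x) - B (f n x)) < e"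
      using CauchyD[OF LIMSEQ_imp_Cauchy[OF lim[of x]]] by blast
    have "norm (X (f m x) - X (f n x)) \<le> norm (B (f m x) - B (f n x))" for m n
      using dom[of "f m x - f n x"] by (simp add: bounded_ops_diff[OF X] bounded_ops_diff[OF Bb])
    then show "\<exists>N. \<forall>m\<ge>N. \<forall>n\<ge>N. norm (X (f m x) - X (f n x)) < e"
      using N by (meson le_less_trans)
  qed
  then obtain A where A: "\<And>x. (\<lambda>n. X (f n x)) \<longlonglongrightarrow> A x"
    unfolding Cauchy_convergent_iff convergent_def by metis
  have fM: "f n \<in> M" for n
  proof (induction n)
    case 0
    have "(\<lambda>x. scaleC 0 (id x)) \<in> M" by (intro vna_smult vna_id M)
    then show ?case by (simp add: f_def)
  next
    case (Suc n)
    have "(\<lambda>y. y - B y) \<in> M" using vna_diff[OF M vna_id[OF M] BM] by simp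
    from vna_plus[OF M Suc vna_funpow[OF M this, of n]] show ?case by (simp add: f_def)
  qed
  have bd: "norm (X (f n x)) \<le> 2 * norm x" for n x
    using dom[of "f n x"] norm_diff_funpow_le[OF B, of x n] unfolding Bf by linarith
  have "A \<in> M"
  proof (rule vna_pointwise_limit[OF M _ A bd])
    show "(\<lambda>x. X (f n x)) \<in> M" for n using vna_comp[OF M XM fM[of n]] by (simp add: comp_def)
  qed
  moreover have "A (B x) = X x" for x
  proof -
    have "X (x - supp B x) = 0"
      using dom[of "x - supp B x"] by (simp add: bounded_ops_diff[OF Bb] comp_supp[OF B])
    then have eq: "X (supp B x) = X x" by (simp add: bounded_ops_diff[OF X])
    have "f n (B x) = B (f n x)" for n
      unfolding f_def using diff_funpow_eq(2)[OF B, of x n] by simp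
    then have "(\<lambda>n. X (f n (B x))) \<longlonglongrightarrow> X (supp B x)"
      using bounded_ops_tendsto[OF X lim[of x]] by simp
    then show ?thesis using A[of "B x"] eq by (simp add: LIMSEQ_unique)
  qed
  ultimately show thesis using A that by blast
qed

lemma aff_MvN_quot:
  fixes T :: "'h::chilbert \<rightharpoonup> 'h"
  assumes M: "von_neumann_algebra M" and T: "T \<in> aff_MvN M"
  obtains A B where "A \<in> M" "B \<in> M" "pos_contr B" "col_isometry A B (supp B)" "T = quot A B"
proof -
  have cl: "closed_op T" using T by (simp add: aff_MvN_def)
  then have T': "unbounded_op T" "closed (Map.graph T)" by (auto simp: closed_op_def)
  let ?P = "charproj T"
  define p11 where "p11 x = fst (?P (x, 0))" for x
  define p21 where "p21 x = snd (?P (x, 0))" for x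
  have Pp: "?P (x, 0) = (p11 x, p21 x)" for x by (simp add: p11_def p21_def)
  have pM: "p11 \<in> M" "p21 \<in> M"
    using charproj_column_vna[OF M T] by (simp_all add: p11_def[abs_def] p21_def[abs_def])
  have PP: "inner (?P p) (?P q) = inner (?P p) q" for p q
    using charproj_graph[OF cl charproj_in_graph[OF cl]] by (simp add: charproj_selfadj[OF cl])
  \<comment> \<open>Idempotence of P, read off in its first column.\<close>
  have gram: "inner (p11 x) (p11 y) + inner (p21 x) (p21 y) = inner (p11 x) y" for x y
    using PP[of "(x, 0)" "(y, 0)"] by (simp add: Pp)
  have "pos_contr p11"
    unfolding pos_contr_def
  proof (intro conjI allI)
    show "p11 \<in> bounded_ops" using M pM(1) by (rule vna_bounded_ops)
    show "inner (p11 x) y = inner x (p11 y)" for x y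
      using charproj_selfadj[OF cl, of "(x, 0)" "(y, 0)"] by (simp add: Pp)
    fix x
    have "0 \<le> inner (p21 x) (p21 x)" "0 \<le> inner (p11 x) (p11 x)" by simp_all
    then show "0 \<le> inner (p11 x) x" using gram[of x x] by linarith
    have "inner (p11 x) (p11 x) \<le> inner (p11 x) x"
      using gram[of x x] inner_ge_zero[of "p21 x"] by linarith
    moreover have "2 * inner (p11 x) x \<le> inner (p11 x) (p11 x) + inner x x"
      using inner_ge_zero[of "p11 x - x"] by (simp add: inner_diff_left inner_diff_right inner_commute)
    ultimately show "inner (p11 x) x \<le> inner x x" by linarith
  qed
  then obtain B where B: "B \<in> M" "pos_contr B" "\<And>x. B (B x) = p11 x"
    using pos_contr_sqrt[OF M pM(1)] by blast
  have Bb: "B \<in> bounded_ops" using M B(1) by (rule vna_bounded_ops)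
  have gramB: "inner (p11 x) (p11 y) + inner (p21 x) (p21 y) = inner (B x) (B y)" for x y
    using gram[of x y] by (simp add: pos_contr_selfadj[OF B(2)] flip: B(3))
  have "norm (p21 y) \<le> norm (B y)" for y
  proof -
    have "inner (p21 y) (p21 y) \<le> inner (B y) (B y)" using gramB[of y y, symmetric] by simp
    then show ?thesis by (simp add: norm_eq_sqrt_inner)
  qed
  then obtain A where A: "A \<in> M" "\<And>x. (\<lambda>n. p21 (\<Sum>k<n. ((\<lambda>y. y - B y) ^^ k) x)) \<longlonglongrightarrow> A x"
    "\<And>x. A (B x) = p21 x"
    using vna_left_quotient[OF M B(1,2) pM(2)] by blast
  \<comment> \<open>\<open>f n\<close> approximates the inverse of \<open>B\<close>, so the vectors
    P(f n x, 0) tend to W x. This yields both the Gram identity of W and the inclusion of its range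
    in the closed graph of \<open>T\<close>.\<close>
  define f where "f n x = (\<Sum>k<n. ((\<lambda>y. y - B y) ^^ k) x)" for n x
  have limA: "(\<lambda>n. p21 (f n x)) \<longlonglongrightarrow> A x" for x using A(2) by (simp add: f_def)
  have limE: "(\<lambda>n. B (f n x)) \<longlonglongrightarrow> supp B x" for x
    using supp_lim[OF B(2), of x] by (simp add: f_def diff_funpow_eq(1)[OF B(2)])
  have limB: "(\<lambda>n. p11 (f n x)) \<longlonglongrightarrow> B x" for x
    using bounded_ops_tendsto[OF Bb limE[of x]] by (simp add: B(3) comp_supp[OF B(2)])
  have Ab: "A \<in> bounded_ops" using M A(1) by (rule vna_bounded_ops)
  have gramW: "inner (B x) (B z) + inner (A x) (A z) = inner (supp B x) z" for x z
  proof (rule LIMSEQ_unique)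
    show "(\<lambda>n. inner (p11 (f n x)) (p11 (f n z)) + inner (p21 (f n x)) (p21 (f n z)))
        \<longlonglongrightarrow> inner (B x) (B z) + inner (A x) (A z)"
      by (intro tendsto_add tendsto_inner limA limB)
    have "(\<lambda>n. inner (B (f n x)) (B (f n z))) \<longlonglongrightarrow> inner (supp B x) (supp B z)"
      by (intro tendsto_inner limE)
    then show "(\<lambda>n. inner (p11 (f n x)) (p11 (f n z)) + inner (p21 (f n x)) (p21 (f n z)))
        \<longlonglongrightarrow> inner (supp B x) z"
      unfolding gramB using supp_selfadj[OF B(2), of "supp B x" z] by (simp add: supp_supp[OF B(2)])
  qed
  have ci: "col_isometry A B (supp B)"
    unfolding col_isometry_def
  proof (intro conjI allI Ab Bb supp_bounded_ops B(2) supp_selfadj supp_supp)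
    show "null B \<subseteq> null (supp B)" using supp_of_null[OF B(2)] by (auto simp: null_def)
    fix x
    have "inner (cadj B (B x) + cadj A (A x)) z = inner (supp B x) z" for z
      using gramW[of x z] by (simp add: inner_add_left Ab Bb flip: cadj_inner_right)
    then show "cadj B (B x) + cadj A (A x) = supp B x" by (rule real_inner_eqI)
  qed
  note gW = graph_col_isometry[OF ci]
  have sub: "Map.graph (quot A B) \<subseteq> Map.graph T"
  proof
    fix p assume "p \<in> Map.graph (quot A B)"
    then obtain x where p: "p = (B x, A x)" by (auto simp: gW)
    have "(\<lambda>n. (p11 (f n x), p21 (f n x))) \<longlonglongrightarrow> p" unfolding p by (intro tendsto_Pair limA limB)
    moreover have "(p11 (f n x), p21 (f n x)) \<in> Map.graph T" for n
      using charproj_in_graph[OF cl, of "(f n x, 0)"] by (simp add: Pp)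
    ultimately show "p \<in> Map.graph T" by (rule closed_sequentially[OF T'(2), rotated])
  qed
  have "Map.graph (quot A B) = Map.graph T"
  proof (rule antisym[OF sub], rule subsetI)
    fix g assume g: "g \<in> Map.graph T"
    let ?Q = "charproj (quot A B)"
    note clW = closed_op_col_isometry[OF ci]
    \<comment> \<open>\<open>h\<close> lies in the graph of \<open>T\<close> and is orthogonal to
      that of the quotient, which contains every P(y, 0). Hence h = P h is orthogonal to all (y, 0),
      and single-valuedness of \<open>T\<close> at 0 leaves h = 0.\<close>
    define h where "h = g - ?Q g"
    have "?Q g \<in> Map.graph T" using charproj_in_graph[OF clW] sub by blast
    then have hT: "h \<in> Map.graph T" unfolding h_def by (intro subspace_diff subspace_graph T' g)
    have "inner (fst h) y = inner 0 y" for y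
    proof -
      have "(p11 y, p21 y) \<in> Map.graph (quot A B)" by (simp add: gW flip: B(3) A(3))
      then have "inner h (?P (y, 0)) = 0" unfolding h_def Pp by (rule charproj_orthogonal[OF clW])
      then have "inner h (y, 0) = 0" using charproj_graph[OF cl hT] charproj_selfadj[OF cl, of h "(y, 0)"] by simp
      then show ?thesis by (simp add: inner_prod_def)
    qed
    then have "fst h = 0" by (rule real_inner_eqI)
    then have "T 0 = Some (snd h)" using hT by (cases h) (simp add: graph_def)
    moreover have "T 0 = Some 0"
      using subspace_0[OF subspace_graph(1)[OF T'(1)]] by (simp add: graph_def zero_prod_def)
    ultimately have "h = 0" using \<open>fst h = 0\<close> by (simp add: prod_eq_iff)
    then show "g \<in> Map.graph (quot A B)"
      using charproj_in_graph[OF clW, of g] by (simp add: h_def)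
  qed
  then have "T = quot A B" by (simp add: map_graph_eq_iff)
  then show thesis using that A(1) B(1,2) ci by blast
qed

section \<open>Transport along a normal homomorphism\<close>

lemma op_le_iff: "op_le A B \<longleftrightarrow> (\<forall>x. inner (A x) x \<le> inner (B x) x)"
  by (simp add: op_le_def inner_eq_Re_cinner)

lemma selfadjI:
  assumes "A \<in> M" "A \<in> bounded_ops" "\<And>x y. inner (A x) y = inner x (A y)"
  shows "A \<in> selfadj M"
  using assms(1) cadj_eqI[OF assms(2,3)] by (simp add: selfadj_def)

text \<open>The support in the form to which normality applies: the quadratic forms of an increasing
  sequence converge to its form, which therefore stays below that of every upper bound.\<close>

lemma op_lub_supp:
  fixes B :: "'h::chilbert \<Rightarrow> 'h"
  defines "D \<equiv> \<lambda>n x. x - ((\<lambda>y. y - B y) ^^ n) x"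
  assumes M: "von_neumann_algebra M" and BM: "B \<in> M" and B: "pos_contr B"
  shows "range D \<subseteq> selfadj M" "\<And>m n. m \<le> n \<Longrightarrow> op_le (D m) (D n)"
    and "op_lub M (range D) (supp B)"
proof -
  note C = pos_contr_compl[OF B]
  have "(\<lambda>y. y - B y) \<in> M" using vna_diff[OF M vna_id[OF M] BM] by simp
  then have DM: "D n \<in> M" for n
    unfolding D_def using vna_diff[OF M vna_id[OF M] vna_funpow[OF M, of _ n]] by simp
  have "D n \<in> selfadj M" for n
    by (rule selfadjI[OF DM vna_bounded_ops[OF M DM]])
      (simp add: D_def inner_diff_left inner_diff_right pos_contr_funpow_selfadj[OF C])
  then show "range D \<subseteq> selfadj M" by blast
  have inc: "incseq (\<lambda>n. inner (D n x) x)" for x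
    by (rule incseq_SucI)
      (use pos_contr_funpow_antimono[OF C] in \<open>simp add: D_def inner_diff_left del: funpow.simps\<close>)
  then show "op_le (D m) (D n)" if "m \<le> n" for m n
    using that by (simp add: op_le_iff incseq_def)
  have lim: "(\<lambda>n. inner (D n x) x) \<longlonglongrightarrow> inner (supp B x) x" for x
    unfolding D_def by (intro tendsto_inner tendsto_const supp_lim B)
  show "op_lub M (range D) (supp B)"
    unfolding op_lub_def
  proof (intro conjI ballI impI)
    show "supp B \<in> selfadj M"
      using supp_vna[OF B M BM] supp_bounded_ops[OF B] supp_selfadj[OF B] by (rule selfadjI)
    show "op_le A (supp B)" if "A \<in> range D" for A
      using that incseq_le[OF inc lim] by (auto simp: op_le_iff)
    show "op_le (supp B) R" if "\<forall>A\<in>range D. op_le A R" for R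
      unfolding op_le_iff
    proof
      fix x
      show "inner (supp B x) x \<le> inner (R x) x"
        using that by (intro LIMSEQ_le_const2[OF lim]) (auto simp: op_le_iff)
    qed
  qed
qed

section \<open>Homomorphisms on positive contractions, supports and quotients\<close>

context
  fixes M :: "('h::chilbert \<Rightarrow> 'h) set" and N :: "('k::chilbert \<Rightarrow> 'k) set"
    and \<Phi> :: "('h \<Rightarrow> 'h) \<Rightarrow> ('k \<Rightarrow> 'k)"
  assumes M: "von_neumann_algebra M" and N: "von_neumann_algebra N"
    and hom: "unital_star_hom M N \<Phi>"
begin

lemma
  shows hom_in: "A \<in> M \<Longrightarrow> \<Phi> A \<in> N"
    and hom_plus: "A \<in> M \<Longrightarrow> B \<in> M \<Longrightarrow> \<Phi> (\<lambda>x. A x + B x) = (\<lambda>y. \<Phi> A y + \<Phi> B y)"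
    and hom_smult: "A \<in> M \<Longrightarrow> \<Phi> (\<lambda>x. scaleC c (A x)) = (\<lambda>y. scaleC c (\<Phi> A y))"
    and hom_comp: "A \<in> M \<Longrightarrow> B \<in> M \<Longrightarrow> \<Phi> (A \<circ> B) = \<Phi> A \<circ> \<Phi> B"
    and hom_cadj: "A \<in> M \<Longrightarrow> \<Phi> (cadj A) = cadj (\<Phi> A)"
    and hom_id: "\<Phi> id = id"
  using hom by (auto simp: unital_star_hom_def)

lemma hom_diff:
  assumes "A \<in> M" "B \<in> M"
  shows "\<Phi> (\<lambda>x. A x - B x) = (\<lambda>y. \<Phi> A y - \<Phi> B y)"
  unfolding diff_eq_plus_scaleC by (simp only: hom_plus hom_smult assms vna_smult[OF M])

lemma hom_funpow: "A \<in> M \<Longrightarrow> \<Phi> (A ^^ n) = \<Phi> A ^^ n"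
  by (induction n) (simp_all add: hom_id[unfolded id_def] hom_id hom_comp vna_funpow[OF M] flip: id_def)

lemma hom_bounded_ops: "A \<in> M \<Longrightarrow> \<Phi> A \<in> bounded_ops"
  by (rule vna_bounded_ops[OF N hom_in])

lemma hom_selfadj:
  assumes "A \<in> M" "cadj A = A"
  shows "inner (\<Phi> A x) y = inner x (\<Phi> A y)"
  using cadj_inner[OF hom_bounded_ops[OF assms(1)], of x y] hom_cadj[OF assms(1)] assms(2) by simp

text \<open>Positivity becomes algebraic once \<open>A\<close> has a self-adjoint square root inside
  \<open>M\<close>.\<close>

lemma hom_nonneg:
  assumes A: "A \<in> M" "pos_contr A"
  shows "0 \<le> inner (\<Phi> A x) x"
proof -
  obtain R where R: "R \<in> M" "pos_contr R" "\<And>x. R (R x) = A x"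
    using pos_contr_sqrt[OF M A] by blast
  have "A = R \<circ> R" using R(3) by (simp add: fun_eq_iff)
  then have "\<Phi> A x = \<Phi> R (\<Phi> R x)" using hom_comp[OF R(1) R(1)] by simp
  then show ?thesis using hom_selfadj[OF R(1) pos_contr_cadj[OF R(2)], of "\<Phi> R x" x] by simp
qed

lemma hom_compl:
  assumes "A \<in> M"
  shows "(\<lambda>x. x - A x) \<in> M" "\<Phi> (\<lambda>x. x - A x) = (\<lambda>y. y - \<Phi> A y)"
  using vna_diff[OF M vna_id[OF M] assms] hom_diff[OF vna_id[OF M] assms] by (simp_all add: hom_id)

lemma hom_pos_contr:
  assumes A: "A \<in> M" "pos_contr A"
  shows "pos_contr (\<Phi> A)"
  unfolding pos_contr_def
proof (intro conjI allI hom_bounded_ops hom_selfadj pos_contr_cadj hom_nonneg A)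
  show "inner (\<Phi> A x) x \<le> inner x x" for x
    using hom_nonneg[OF hom_compl(1)[OF A(1)] pos_contr_compl[OF A(2)], of x]
    by (simp add: hom_compl[OF A(1)] inner_diff_left)
qed

lemma
  assumes BM: "B \<in> M" and B: "pos_contr B"
  shows hom_supp_selfadj: "inner (\<Phi> (supp B) x) y = inner x (\<Phi> (supp B) y)"
    and hom_supp_idem: "\<Phi> (supp B) (\<Phi> (supp B) x) = \<Phi> (supp B) x"
proof -
  have EM: "supp B \<in> M" using supp_vna[OF B M BM] .
  have "cadj (supp B) = supp B"
    using supp_bounded_ops[OF B] supp_selfadj[OF B] by (rule cadj_eqI)
  then show "inner (\<Phi> (supp B) x) y = inner x (\<Phi> (supp B) y)" by (rule hom_selfadj[OF EM])
  have "supp B \<circ> supp B = supp B" using supp_supp[OF B] by (simp add: fun_eq_iff)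
  then have "\<Phi> (supp B) \<circ> \<Phi> (supp B) = \<Phi> (supp B)" using hom_comp[OF EM EM] by simp
  from fun_cong[OF this, of x] show "\<Phi> (supp B) (\<Phi> (supp B) x) = \<Phi> (supp B) x" by simp
qed

text \<open>Normality enters here only: \<open>supp (\<Phi> B)\<close> dominates each \<open>1 - (1 - \<Phi> B)\<^sup>n\<close>, hence also
  \<open>\<Phi> (supp B)\<close>.\<close>

lemma normal_hom_null_supp:
  assumes normal: "normal_map M N \<Phi>" and BM: "B \<in> M" and B: "pos_contr B"
  shows "null (\<Phi> B) \<subseteq> null (\<Phi> (supp B))"
proof
  fix y assume y: "y \<in> null (\<Phi> B)"
  define D where "D n x = x - ((\<lambda>y. y - B y) ^^ n) x" for n x
  define D' where "D' n x = x - ((\<lambda>y. y - \<Phi> B y) ^^ n) x" for n x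
  have D_eq: "D = (\<lambda>n x. x - ((\<lambda>y. y - B y) ^^ n) x)"
    and D'_eq: "D' = (\<lambda>n x. x - ((\<lambda>y. y - \<Phi> B y) ^^ n) x)"
    by (simp_all add: D_def fun_eq_iff D'_def)
  note lub = op_lub_supp[OF M BM B, folded D_eq]
  note B' = hom_pos_contr[OF BM B]
  note lub' = op_lub_supp[OF N hom_in[OF BM] B', folded D'_eq]
  \<comment> \<open>The approximants are polynomials, so \<open>\<Phi>\<close> carries those of
    \<open>B\<close> to those of \<open>\<Phi> B\<close>, and both suprema are taken over one
    set.\<close>
  have "\<Phi> (D n) = D' n" for n
    using hom_compl(2)[OF vna_funpow[OF M hom_compl(1)[OF BM]], of n]
    by (simp add: D_def[abs_def] D'_def[abs_def] hom_funpow[OF hom_compl(1)[OF BM]] hom_compl(2)[OF BM])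
  then have img: "\<Phi> ` range D = range D'" by (simp add: image_image)
  have "\<exists>C\<in>range D. op_le A C \<and> op_le A' C" if A: "A \<in> range D" "A' \<in> range D" for A A'
  proof -
    obtain m n where "A = D m" "A' = D n" using A by blast
    then have "op_le A (D (max m n)) \<and> op_le A' (D (max m n))"
      using op_lub_supp(2)[OF M BM B, of _ "max m n"] by (simp add: D_eq)
    then show ?thesis by blast
  qed
  then have "range D \<subseteq> selfadj M \<and> range D \<noteq> {} \<and>
      (\<forall>A\<in>range D. \<forall>A'\<in>range D. \<exists>C\<in>range D. op_le A C \<and> op_le A' C) \<and> op_lub M (range D) (supp B)"
    using lub(1,3) by simp
  then have "op_lub N (\<Phi> ` range D) (\<Phi> (supp B))"
    using normal unfolding normal_map_def by (elim allE impE)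
  then have "op_lub N (range D') (\<Phi> (supp B))" unfolding img .
  then have "op_le (\<Phi> (supp B)) (supp (\<Phi> B))"
    using lub'(3) by (simp add: op_lub_def)
  then have "inner (\<Phi> (supp B) y) y \<le> inner (supp (\<Phi> B) y) y" by (simp add: op_le_iff)
  also have "\<dots> = 0" using supp_of_null[OF B'] y by (simp add: null_def)
  finally have le: "inner (\<Phi> (supp B) y) y \<le> 0" .
  \<comment> \<open>For a projection the quadratic form is a squared norm, so a nonpositive value
    means 0.\<close>
  have "inner (\<Phi> (supp B) y) (\<Phi> (supp B) y) = inner (\<Phi> (supp B) y) y"
    using hom_supp_selfadj[OF BM B, of "\<Phi> (supp B) y" y] hom_supp_idem[OF BM B, of y] by simp
  then have "inner (\<Phi> (supp B) y) (\<Phi> (supp B) y) \<le> 0" using le by linarith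
  then have "\<Phi> (supp B) y = 0" using inner_gt_zero_iff not_less by blast
  then show "y \<in> null (\<Phi> (supp B))" by (simp add: null_def)
qed

text \<open>The identities among the clauses pass through \<open>\<Phi>\<close> algebraically; the
  kernel inclusion is where normality comes in.\<close>

lemma hom_col_isometry:
  assumes normal: "normal_map M N \<Phi>" and AM: "A \<in> M" and BM: "B \<in> M" and B: "pos_contr B"
    and ci: "col_isometry A B (supp B)"
  shows "col_isometry (\<Phi> A) (\<Phi> B) (\<Phi> (supp B))"
  unfolding col_isometry_def
proof (intro conjI allI normal_hom_null_supp normal BM B hom_bounded_ops AM hom_supp_selfadj
    hom_supp_idem)
  show EM: "supp B \<in> M" using supp_vna[OF B M BM] .
  have "supp B = (\<lambda>x. (cadj B \<circ> B) x + (cadj A \<circ> A) x)"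
    by (simp add: fun_eq_iff col_isometry_eq[OF ci])
  then have "\<Phi> (supp B) = (\<lambda>y. \<Phi> (cadj B \<circ> B) y + \<Phi> (cadj A \<circ> A) y)"
    using hom_plus[OF vna_comp[OF M vna_cadj[OF M BM] BM] vna_comp[OF M vna_cadj[OF M AM] AM]]
    by simp
  then show "cadj (\<Phi> B) (\<Phi> B x) + cadj (\<Phi> A) (\<Phi> A x) = \<Phi> (supp B) x" for x
    by (simp add: hom_comp AM BM vna_cadj[OF M] hom_cadj)
qed

text \<open>Any other representation \<open>A' / B'\<close> factors through \<open>(B, A)\<close> by \<open>C = B\<^sup>* B' + A\<^sup>* A'\<close>; as the
  range of \<open>C\<close> is that of the support projection, \<open>C\<close> has a right inverse there, inside \<open>M\<close>.\<close>

lemma hom_quot_eq: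
  assumes normal: "normal_map M N \<Phi>" and AM: "A \<in> M" and BM: "B \<in> M" and B: "pos_contr B"
    and ci: "col_isometry A B (supp B)"
    and AM': "A' \<in> M" and BM': "B' \<in> M" and le': "null B' \<subseteq> null A'"
    and eq: "quot A' B' = quot A B"
  shows "quot (\<Phi> A') (\<Phi> B') = quot (\<Phi> A) (\<Phi> B)"
proof -
  let ?E = "supp B"
  have EM: "?E \<in> M" using supp_vna[OF B M BM] .
  note bo = vna_bounded_ops[OF M]
  define C where "C x = cadj B (B' x) + cadj A (A' x)" for x
  have CM: "C \<in> M"
    using vna_plus[OF M vna_comp[OF M vna_cadj[OF M BM] BM'] vna_comp[OF M vna_cadj[OF M AM] AM']]
    by (simp add: C_def[abs_def])
  have ranges: "range (\<lambda>x. (B' x, A' x)) = range (\<lambda>x. (B x, A x))"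
    using graph_col_isometry[OF ci] graph_quot[OF bo[OF AM'] bo[OF BM'] le'] eq by simp
  have EC: "?E (C x) = C x" for x
    by (simp add: C_def bounded_ops_add[OF bo[OF EM]] col_isometry_cadj[OF ci])
  have fac: "B' x = B (C x)" "A' x = A (C x)" for x
  proof -
    have "(B' x, A' x) \<in> range (\<lambda>x. (B x, A x))" unfolding ranges[symmetric] by blast
    then obtain z where z: "B' x = B z" "A' x = A z" by blast
    then have "C x = ?E z" by (simp add: C_def col_isometry_eq[OF ci])
    then show "B' x = B (C x)" "A' x = A (C x)" using z by (simp_all add: col_isometry_comp[OF ci])
  qed
  have "\<exists>z. C z = ?E x" for x
  proof -
    have "(B x, A x) \<in> range (\<lambda>x. (B' x, A' x))" unfolding ranges by blast
    then obtain z where z: "B x = B' z" "A x = A' z" by blast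
    have "?E x = cadj B (B x) + cadj A (A x)" by (simp add: col_isometry_eq[OF ci])
    then show ?thesis using z by (auto simp: C_def)
  qed
  then obtain D where DM: "D \<in> M" and D: "\<And>x. C (D x) = ?E x"
    using vna_right_factor[OF M CM EM supp_selfadj[OF B] EC] by blast
  \<comment> \<open>With W and W' the columns of the two representations, W' D = W C D = W E =
    W.\<close>
  have fac': "B x = B' (D x)" "A x = A' (D x)" for x
    by (simp_all add: fac D col_isometry_comp[OF ci])
  have hom_fac: "\<Phi> X y = \<Phi> Y (\<Phi> Z y)" if "Y \<in> M" "Z \<in> M" "\<And>x. X x = Y (Z x)" for X Y Z y
  proof -
    have "X = Y \<circ> Z" using that(3) by (simp add: fun_eq_iff)
    then show ?thesis using hom_comp[OF that(1,2)] by simp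
  qed
  have ci': "col_isometry (\<Phi> A) (\<Phi> B) (\<Phi> ?E)" by (rule hom_col_isometry[OF normal AM BM B ci])
  show ?thesis
    by (rule quot_eqI(2)[OF hom_bounded_ops[OF AM] hom_bounded_ops[OF BM] col_isometry_null[OF ci']
          hom_fac[OF AM CM fac(2)] hom_fac[OF BM CM fac(1)] hom_fac[OF AM' DM fac'(2)]
          hom_fac[OF BM' DM fac'(1)] hom_bounded_ops[OF AM'] hom_bounded_ops[OF BM']])
qed

text \<open>The definite description in \<open>aff_ext\<close> ranges over all representations;
  since \<open>hom_quot_eq\<close> makes them agree, it may be evaluated at the partial
  isometry.\<close>

lemma aff_ext_quot:
  assumes normal: "normal_map M N \<Phi>" and AM: "A \<in> M" and BM: "B \<in> M" and B: "pos_contr B"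
    and ci: "col_isometry A B (supp B)"
  shows "aff_ext M \<Phi> (quot A B) = quot (\<Phi> A) (\<Phi> B)"
proof -
  have "quot A B \<in> aff M" using AM BM col_isometry_null[OF ci] by (auto simp: aff_def)
  moreover have "(THE S. \<exists>A'\<in>M. \<exists>B'\<in>M. null B' \<subseteq> null A' \<and> quot A B = quot A' B' \<and>
      S = quot (\<Phi> A') (\<Phi> B')) = quot (\<Phi> A) (\<Phi> B)"
  proof (rule the_equality)
    show "\<exists>A'\<in>M. \<exists>B'\<in>M. null B' \<subseteq> null A' \<and> quot A B = quot A' B' \<and>
        quot (\<Phi> A) (\<Phi> B) = quot (\<Phi> A') (\<Phi> B')"
      using AM BM col_isometry_null[OF ci] by blast
    fix S assume "\<exists>A'\<in>M. \<exists>B'\<in>M. null B' \<subseteq> null A' \<and> quot A B = quot A' B' \<and>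
      S = quot (\<Phi> A') (\<Phi> B')"
    then obtain A' B' where "A' \<in> M" "B' \<in> M" "null B' \<subseteq> null A'" "quot A' B' = quot A B"
      and S: "S = quot (\<Phi> A') (\<Phi> B')" by auto
    then show "S = quot (\<Phi> A) (\<Phi> B)"
      unfolding S by (intro hom_quot_eq[OF normal AM BM B ci])
  qed
  ultimately show ?thesis by (simp add: aff_ext_def)
qed

lemma entrywise_charproj:
  assumes AM: "A \<in> M" and BM: "B \<in> M" and ci: "col_isometry A B E"
    and ci': "col_isometry (\<Phi> A) (\<Phi> B) E'"
  shows "entrywise M \<Phi> (charproj (quot A B)) = charproj (quot (\<Phi> A) (\<Phi> B))"
proof -
  have zero: "cadj A 0 = 0" "cadj B 0 = 0" "A 0 = 0" "B 0 = 0"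
    using AM BM by (simp_all add: bounded_ops_zero vna_bounded_ops[OF M] vna_cadj[OF M])
  let ?S = "opmat (B \<circ> cadj B) (B \<circ> cadj A) (A \<circ> cadj B) (A \<circ> cadj A)"
  have SM: "?S \<in> mat2 M"
    unfolding mat2_def using AM BM vna_comp[OF M] vna_cadj[OF M] by blast
  have "(\<lambda>x. fst (?S (x, 0))) = B \<circ> cadj B" "(\<lambda>y. fst (?S (0, y))) = B \<circ> cadj A"
    "(\<lambda>x. snd (?S (x, 0))) = A \<circ> cadj B" "(\<lambda>y. snd (?S (0, y))) = A \<circ> cadj A"
    by (simp_all add: opmat_def fun_eq_iff zero)
  then have "entrywise M \<Phi> ?S = opmat (\<Phi> (B \<circ> cadj B)) (\<Phi> (B \<circ> cadj A)) (\<Phi> (A \<circ> cadj B)) (\<Phi> (A \<circ> cadj A))"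
    using SM by (simp add: entrywise_def)
  then show ?thesis
    by (simp add: charproj_col_isometry[OF ci] charproj_col_isometry[OF ci'] hom_comp hom_cadj AM BM
        vna_cadj[OF M])
qed

end

text \<open>\<open>U\<close> and \<open>cadj U\<close> both commute with \<open>B\<close>, so
  \<open>x\<close> lies in the range of \<open>B\<close> exactly when \<open>U x\<close> does; on
  that range commutation with \<open>A\<close> matches the values.\<close>

lemma quot_in_aff_MvN:
  assumes N: "von_neumann_algebra N" and AN: "A \<in> N" and BN: "B \<in> N" and ci: "col_isometry A B E"
  shows "quot A B \<in> aff_MvN N"
  unfolding aff_MvN_def
proof (intro CollectI conjI ballI impI closed_op_col_isometry[OF ci])
  fix U assume U: "U \<in> commutant N" "unitary_op U"
  note u = unitary_op_simps[OF U(2)]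
  note V = commutant_cadj[OF N U(1)]
  note qa = quot_apply[OF vna_bounded_ops[OF N AN] vna_bounded_ops[OF N BN] col_isometry_null[OF ci]]
  show "(\<lambda>x. map_option (cadj U) (quot A B (U x))) = quot A B"
  proof
    fix x
    show "map_option (cadj U) (quot A B (U x)) = quot A B x"
    proof (cases "x \<in> range B")
      case True
      then obtain z where "x = B z" by blast
      then show ?thesis
        using qa[of "U z"] qa[of z] by (simp add: commutantD[OF U(1) BN] commutantD[OF U(1) AN, symmetric] u(2))
    next
      case False
      have "U x \<notin> range B"
      proof
        assume "U x \<in> range B"
        then obtain z where "U x = B z" by blast
        then have "x = B (cadj U z)" using u(2)[of x] commutantD[OF V BN, of z] by simp
        then show False using False by blast
      qed
      then show ?thesis using False by (simp add: quot_def)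
    qed
  qed
qed

theorem theorem5p7:
  fixes M :: "('h::chilbert \<Rightarrow> 'h) set" and N :: "('k::chilbert \<Rightarrow> 'k) set"
    and \<Phi> :: "('h \<Rightarrow> 'h) \<Rightarrow> ('k \<Rightarrow> 'k)"
  assumes "von_neumann_algebra M" and "von_neumann_algebra N"
    and "unital_star_hom M N \<Phi>" and "normal_map M N \<Phi>"
  shows "(\<forall>T\<in>aff_MvN M. charproj (aff_ext M \<Phi> T) = entrywise M \<Phi> (charproj T)) \<and>
    aff_ext M \<Phi> \<in> aff_MvN M \<rightarrow> aff_MvN N \<and>
    (\<forall>T\<in>aff_MvN M. aff_ext M \<Phi> T =
       (inv_into (aff_MvN N) charproj \<circ> entrywise M \<Phi> \<circ> charproj) T)"
proof -
  have main: "charproj (aff_ext M \<Phi> T) = entrywise M \<Phi> (charproj T) \<and> aff_ext M \<Phi> T \<in> aff_MvN N"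
    if T: "T \<in> aff_MvN M" for T
  proof -
    obtain A B where AB: "A \<in> M" "B \<in> M" "pos_contr B" "col_isometry A B (supp B)"
      and T_eq: "T = quot A B"
      using aff_MvN_quot[OF assms(1) T] by blast
    note ext = aff_ext_quot[OF assms AB]
    note ci' = hom_col_isometry[OF assms AB]
    show ?thesis
      unfolding T_eq ext
      using entrywise_charproj[OF assms(1-3) AB(1,2,4) ci']
        quot_in_aff_MvN[OF assms(2) _ _ ci'] hom_in[OF assms(1-3)] AB(1,2) by simp
  qed
  \<comment> \<open>\<open>inv_into\<close> recovers the value because that value is known to lie in
    \<open>aff_MvN N\<close>.\<close>
  have "inj_on charproj (aff_MvN N)"
    by (rule inj_on_subset[OF inj_on_charproj]) (auto simp: aff_MvN_def)
  then have "aff_ext M \<Phi> T = inv_into (aff_MvN N) charproj (entrywise M \<Phi> (charproj T))"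
    if "T \<in> aff_MvN M" for T
    using main[OF that] by (metis inv_into_f_f)
  then show ?thesis using main by auto
qed

end
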